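(* Let $\omega>0$, let $L>1$ be an integer and let $t_o$ satisfy $(L-1)\frac{\pi}{\omega}<t_o<L\frac{\pi}{\omega}$. Let $\varphi_1,\dots,\varphi_L$ be defined by $\widehat{\varphi_j}(x)=(ix)^{j-1}\chi_{[-\omega,\omega]}(x)$, and let $\varphi_1^*,\dots,\varphi_L^*$ be the dual generators of the frame $\{\tau_{nt_o}\varphi_j:n\in\mathbb Z,\ 1\le j\le L\}$ of $B_\omega$, so that every $f\in B_\omega$ has the derivative sampling expansion $$f(x)=\sqrt{2\pi}\sum_{j=1}^L\sum_{n\in\mathbb Z}(-1)^{j-1}f^{(j-1)}(nt_o)\,\varphi_j^*(x-nt_o).$$ Then, for any finite set $\mathcal I\subset\mathbb Z$, in this sampling formula it is possible to recover the missing samples $f^{(j)}(nt_o)$, $n\in\mathcal I$, $0\le j\le L-1$, from the remaining ones; that is, for $f\in B_\omega$ these samples are uniquely determined by the samples $f^{(j)}(nt_o)$, $n\in\mathbb Z\setminus\mathcal I$, $0\le j\le L-1$ (if $f,g\in B_\omega$ satisfy $f^{(j)}(nt_o)=g^{(j)}(nt_o)$ for all $n\notin\mathcal I$ and $0\le j\le L-1$, then the same equalities hold for all $n\in\mathcal I$ and $0\le j\le L-1$).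
   Context: Fourier transform: $\widehat f(\xi)=\frac1{\sqrt{2\pi}}\int f(t)e^{-it\xi}\,dt$. $B_\omega$ is the space of $f\in L^2(\mathbb R)$ whose Fourier transform is supported in $[-\omega,\omega]$ (its elements are smooth functions). $\tau_af(x)=f(x+a)$; $\chi_{[-\omega,\omega]}$ is the indicator function of $[-\omega,\omega]$. Under the stated condition on $t_o$ the family $\{\tau_{nt_o}\varphi_j\}$ is a frame for $B_\omega$, i.e. $A\|f\|^2\le\sum_{j}\sum_{n}|\langle f,\tau_{nt_o}\varphi_j\rangle|^2\le B\|f\|^2$ for all $f\in B_\omega$ and some $0<A\le B$; the dual generators are $\varphi_j^*=S^{-1}\varphi_j$, where $Sf=\sum_{j}\sum_{n}\langle f,\tau_{nt_o}\varphi_j\rangle\tau_{nt_o}\varphi_j$ is the (invertible) frame operator on $B_\omega$. *)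

theory Defs
  imports "HOL-Analysis.Analysis"
begin

definition L2_functions :: "(real \<Rightarrow> complex) set" where
  "L2_functions =
     {f. f \<in> borel_measurable lborel \<and> integrable lborel (\<lambda>x. (cmod (f x))\<^sup>2)}"

definition L2_inner :: "(real \<Rightarrow> complex) \<Rightarrow> (real \<Rightarrow> complex) \<Rightarrow> complex" where
  "L2_inner f g = (LINT x|lborel. f x * cnj (g x))"

text \<open>The squared distance is a nonnegative integral with values in the extended
  reals, so that, unlike for the Bochner integral, a non-integrable difference has
  distance infinity rather than zero.\<close>

definition L2_dist_sq :: "(real \<Rightarrow> complex) \<Rightarrow> (real \<Rightarrow> complex) \<Rightarrow> ennreal" where
  "L2_dist_sq f g = (\<integral>\<^sup>+ x. ennreal ((cmod (f x - g x))\<^sup>2) \<partial>lborel)"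

text \<open>The Fourier transform on the square-integrable functions, in the sense of
  Plancherel: \<open>F\<close> (determined up to null sets) is the mean-square limit of the
  transforms of the truncations of \<open>f\<close> to \<open>[-R, R]\<close>, which are integrable.\<close>

definition has_L2_fourier_transform ::
    "(real \<Rightarrow> complex) \<Rightarrow> (real \<Rightarrow> complex) \<Rightarrow> bool" where
  "has_L2_fourier_transform f F \<longleftrightarrow>
     f \<in> L2_functions \<and> F \<in> L2_functions \<and>
     ((\<lambda>R. L2_dist_sq
              (\<lambda>\<xi>. of_real (1 / sqrt (2 * pi)) *
                    (LINT t:{-R..R}|lborel. f t * exp (- (\<i> * of_real t * of_real \<xi>))))
              F)
        \<longlongrightarrow> 0) at_top"

text \<open>Elements of this space are classes modulo null sets; each class contains exactly
  one continuous function (which is then smooth), and the class is represented by it,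
  so that point values and derivatives make sense.\<close>

definition bandlimited :: "real \<Rightarrow> (real \<Rightarrow> complex) set" where
  "bandlimited \<omega> =
     {f. continuous_on UNIV f \<and> f \<in> L2_functions \<and>
         (\<exists>F. has_L2_fourier_transform f F \<and>
              (AE \<xi> in lborel. \<xi> \<notin> {-\<omega>..\<omega>} \<longrightarrow> F \<xi> = 0))}"

definition nth_deriv :: "nat \<Rightarrow> (real \<Rightarrow> complex) \<Rightarrow> real \<Rightarrow> complex" where
  "nth_deriv k f = ((\<lambda>g x. vector_derivative g (at x)) ^^ k) f"

definition translate :: "real \<Rightarrow> (real \<Rightarrow> complex) \<Rightarrow> real \<Rightarrow> complex" where
  "translate a f = (\<lambda>x. f (x + a))"

text \<open>\<open>S f = g\<close> for the frame operator \<open>S\<close> of the family of all translates of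
  \<open>\<phi> 1, \<dots>, \<phi> L\<close> by integer multiples of \<open>t\<close>; the series is summed
  unconditionally in the mean-square norm.\<close>

definition frame_operator_maps ::
    "nat \<Rightarrow> real \<Rightarrow> (nat \<Rightarrow> real \<Rightarrow> complex) \<Rightarrow>
     (real \<Rightarrow> complex) \<Rightarrow> (real \<Rightarrow> complex) \<Rightarrow> bool" where
  "frame_operator_maps L t \<phi> f g \<longleftrightarrow>
     ((\<lambda>K. L2_dist_sq
              (\<lambda>x. \<Sum>(j, n)\<in>K.
                 L2_inner f (translate (of_int n * t) (\<phi> j)) * translate (of_int n * t) (\<phi> j) x)
              g)
        \<longlongrightarrow> 0) (finite_subsets_at_top ({1..L} \<times> (UNIV :: int set)))"

text \<open>The condition \<open>\<phi>' j = S\<inverse> (\<phi> j)\<close>, stated as \<open>S (\<phi>' j) = \<phi> j\<close> with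
  \<open>\<phi>' j\<close> in the space on which \<open>S\<close> is invertible when the family is a frame.\<close>

definition dual_generators ::
    "real \<Rightarrow> nat \<Rightarrow> real \<Rightarrow> (nat \<Rightarrow> real \<Rightarrow> complex) \<Rightarrow> (nat \<Rightarrow> real \<Rightarrow> complex) \<Rightarrow> bool" where
  "dual_generators \<omega> L t \<phi> \<phi>' \<longleftrightarrow>
     (\<forall>j\<in>{1..L}. \<phi>' j \<in> bandlimited \<omega> \<and> frame_operator_maps L t \<phi> (\<phi>' j) (\<phi> j))"

end

theory Submission
  imports Defs "HOL-Probability.Probability" "HOL-Real_Asymp.Real_Asymp"
    "HOL-Complex_Analysis.Complex_Analysis"
begin

text \<open>
  By linearity it suffices that a band-limited \<open>h\<close> whose derivative samples of order below \<open>L\<close>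
  vanish at all points \<open>n t\<close> with \<open>n\<close> outside the finite set \<open>I\<close> has only vanishing samples.

  \<^bold>\<open>Reduction to integrals.\<close> With \<open>F\<close> the Fourier transform of \<open>h\<close> (up to a constant),
  \<open>h x = \<integral> F \<xi> e\<^sup>i\<^sup>x\<^sup>\<xi> d\<xi>\<close> at every point \<open>x\<close>, and \<open>F\<close> is integrable and
  carried by \<open>{-\<omega>..\<omega>}\<close> (\<open>bandlimited_representation\<close>). This is obtained from the mean-square
  definition of the transform by testing against Gaussians, which are their own transforms and
  form an approximate identity. The derivatives of \<open>h\<close> are then the integrals of
  \<open>F \<xi> (\<i>\<xi>)\<^sup>j e\<^sup>i\<^sup>x\<^sup>\<xi>\<close> (\<open>nth_deriv_fourier_integral\<close>).

  \<^bold>\<open>Periodization by duality.\<close> The samples \<open>H j n\<close> of the \<open>j\<close>-th derivative are the Fourier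
  coefficients of the periodization of \<open>F \<xi> (\<i>\<xi>)\<^sup>j\<close> with period \<open>2\<pi>/t\<close>. As only finitely many
  of them are nonzero, this periodization is the trigonometric polynomial \<open>T\<^sub>j\<close> with these
  coefficients. The form in which this is used avoids pointwise statements about integrable
  functions: integrating \<open>F \<xi> (\<i>\<xi>)\<^sup>j\<close> against a continuous periodic function equals integrating
  \<open>T\<^sub>j\<close> against it over one period (\<open>derivative_sampling_identity\<close>). For trigonometric
  polynomials this is a computation, and they are dense by the Stone-Weierstrass theorem.

  \<^bold>\<open>Elimination.\<close> Since \<open>\<omega> t < L \<pi>\<close>, there is an interval of residues modulo \<open>2\<pi>/t\<close> that have
  at most \<open>L - 1\<close> representatives in the band. For a residue \<open>s\<close> in it, let \<open>Q\<^sub>s\<close> be the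
  monic polynomial of degree \<open>L - 1\<close> with these representatives (times \<open>\<i>\<close>) among its roots. At
  \<open>s\<close>, the periodization of \<open>F \<xi> * Q\<^sub>s(\<i>\<xi>)\<close> has only zero terms, so the combination of the
  \<open>L\<close> periodizations with the coefficients of \<open>Q\<^sub>s\<close> is zero there.
  Hence \<open>E s = \<Sum>\<^sub>j coeff Q\<^sub>s j * T\<^sub>j s\<close> vanishes on an interval, and therefore everywhere
  because it is entire. Replacing \<open>s\<close> by \<open>s + 2\<pi>r\<close> moves the roots of \<open>Q\<^sub>s\<close> by \<open>r\<close> places
  and leaves \<open>T\<^sub>j\<close> unchanged. So the functional sending the monomial \<open>X\<^sup>j\<close> to \<open>T\<^sub>j s\<close> kills the
  products of any \<open>L - 1\<close> consecutive linear factors, hence all polynomials of degree below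
  \<open>L\<close> (\<open>functional_zero_if_zero_on_windows\<close>). Thus \<open>T\<^sub>j = 0\<close>, and so are its coefficients.
\<close>

section \<open>Square-integrable functions and Gaussians\<close>

lemma L2_mult_integrable:
  assumes "f \<in> L2_functions" "g \<in> L2_functions"
  shows "integrable lborel (\<lambda>x. f x * g x)"
proof (rule Bochner_Integration.integrable_bound)
  show "integrable lborel (\<lambda>x. (cmod (f x))\<^sup>2 + (cmod (g x))\<^sup>2)"
    using assms by (auto simp: L2_functions_def)
  show "(\<lambda>x. f x * g x) \<in> borel_measurable lborel"
    using assms by (auto simp: L2_functions_def)
  have "cmod (f x) * cmod (g x) \<le> (cmod (f x))\<^sup>2 + (cmod (g x))\<^sup>2" for x
  proof -
    have "0 \<le> cmod (f x) * cmod (g x)" by simp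
    then show ?thesis
      using sum_squares_bound[of "cmod (f x)" "cmod (g x)"] by linarith
  qed
  then show "AE x in lborel. norm (f x * g x) \<le> norm ((cmod (f x))\<^sup>2 + (cmod (g x))\<^sup>2)"
    by (auto simp: norm_mult)
qed

lemma L2_cmult: "f \<in> L2_functions \<Longrightarrow> (\<lambda>x. c * f x) \<in> L2_functions"
  by (auto simp: L2_functions_def norm_mult power_mult_distrib)

lemma indicator_Icc_L2: "(\<lambda>t. indicator {a..b} t :: complex) \<in> L2_functions"
proof -
  have "(cmod (indicator {a..b} t))\<^sup>2 = indicator {a..b} t" for t :: real
    by (simp add: indicator_def)
  then show ?thesis
    by (auto simp: L2_functions_def integrable_real_indicator emeasure_lborel_Icc_eq)
qed

lemma std_normal_density_le_1: "std_normal_density x \<le> 1"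
proof -
  have "1 \<le> sqrt (2 * pi)" using pi_gt3 by auto
  then show ?thesis
    unfolding std_normal_density_def by (intro mult_le_one) (auto simp: divide_simps)
qed

text \<open>This is the characteristic function of the standard normal distribution, rescaled. Up to
  constants, the density with standard deviation \<open>m\<close> on the frequency side becomes the one with
  standard deviation \<open>1 / m\<close>, which concentrates at the origin as \<open>m\<close> grows.\<close>

lemma fourier_gaussian:
  fixes a m :: real
  assumes "m > 0"
  shows "(LINT \<xi>|lborel. exp (\<i> * of_real (a * \<xi>)) * of_real (std_normal_density (\<xi> / m))) =
         of_real (sqrt (2 * pi) * (m * std_normal_density (m * a)))"
proof -
  have "(LINT \<xi>|lborel. exp (\<i> * of_real (a * \<xi>)) * of_real (std_normal_density (\<xi> / m)))
      = m *\<^sub>R (LINT u|lborel. exp (\<i> * of_real (a * (0 + m * u))) * of_real (std_normal_density ((0 + m * u) / m)))"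
    using assms by (subst lborel_integral_real_affine[of m _ 0]) auto
  also have "\<dots> = m *\<^sub>R (LINT u|lborel. std_normal_density u *\<^sub>R exp (\<i> * of_real ((a * m) * u)))"
    using assms by (simp add: scaleR_conv_of_real mult_ac)
  also have "(LINT u|lborel. std_normal_density u *\<^sub>R exp (\<i> * of_real ((a * m) * u)))
      = char std_normal_distribution (a * m)"
    unfolding char_def by (subst integral_density) (auto simp: normal_density_nonneg)
  also have "\<dots> = of_real (exp (- (a * m)\<^sup>2 / 2))"
    by (simp add: char_std_normal_distribution)
  finally show ?thesis
    by (simp add: std_normal_density_def scaleR_conv_of_real mult_ac)
qed

lemma gaussian_L2:
  assumes "m > 0"
  shows "(\<lambda>\<xi>. of_real (std_normal_density (m * \<xi> + b)) :: complex) \<in> L2_functions"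
proof -
  have m: "(\<lambda>\<xi>. of_real (std_normal_density (m * \<xi> + b)) :: complex) \<in> borel_measurable lborel"
    by measurable
  have "integrable lborel (\<lambda>x. std_normal_density (b + m * x))"
    using assms by (intro lborel_integrable_real_affine) auto
  moreover have "(std_normal_density (m * x + b))\<^sup>2 \<le> 1 * std_normal_density (m * x + b)" for x
    unfolding power2_eq_square
    by (intro mult_right_mono std_normal_density_le_1) (auto simp: normal_density_nonneg)
  ultimately have "integrable lborel (\<lambda>x. (std_normal_density (m * x + b))\<^sup>2)"
    by (intro Bochner_Integration.integrable_bound[where g = "\<lambda>x. (std_normal_density (m * x + b))\<^sup>2"
          and f = "\<lambda>x. std_normal_density (b + m * x)"])
       (auto simp: add.commute normal_density_nonneg)
  with m show ?thesis
    by (simp add: L2_functions_def)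
qed

lemma scaled_gaussian_L2:
  "(\<lambda>t. complex_of_real (Suc n * std_normal_density (Suc n * (t - x)))) \<in> L2_functions"
proof -
  have "(\<lambda>t. of_nat (Suc n) * complex_of_real (std_normal_density (Suc n * t + (- (Suc n * x))))) \<in> L2_functions"
    by (intro L2_cmult gaussian_L2) auto
  then show ?thesis
    by (simp add: right_diff_distrib)
qed

text \<open>Fubini's theorem moves the exponential from a truncation of \<open>f\<close> to the integrable test
  function \<open>\<gamma>\<close>. As the truncation grows, the frequency side converges by the Cauchy-Schwarz
  inequality, because the truncated transforms converge in mean square, and the time side by
  dominated convergence.\<close>

lemma fourier_duality:
  assumes FT: "has_L2_fourier_transform f F"
    and \<gamma>: "integrable lborel \<gamma>" "\<gamma> \<in> L2_functions"
    and \<gamma>': "\<And>t. \<gamma>' t = (LINT \<xi>|lborel. \<gamma> \<xi> * exp (- (\<i> * of_real t * of_real \<xi>)))"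
            "\<gamma>' \<in> L2_functions"
  shows "(LINT \<xi>|lborel. F \<xi> * \<gamma> \<xi>) = of_real (1 / sqrt (2 * pi)) * (LINT t|lborel. f t * \<gamma>' t)"
proof -
  define c :: complex where "c = of_real (1 / sqrt (2 * pi))"
  define e where "e = (\<lambda>t \<xi>. exp (- (\<i> * complex_of_real t * complex_of_real \<xi>)))"
  have e1: "cmod (e t \<xi>) = 1" for t \<xi>
    by (simp add: e_def)
  have fL: "f \<in> L2_functions" and FL: "F \<in> L2_functions"
    using FT by (auto simp: has_L2_fourier_transform_def)
  have [measurable]: "f \<in> borel_measurable borel" "F \<in> borel_measurable borel"
      "\<gamma> \<in> borel_measurable borel" "\<gamma>' \<in> borel_measurable borel"
    using fL FL \<gamma> \<gamma>' by (auto simp: L2_functions_def)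
  have [measurable]: "(\<lambda>(t, \<xi>). e t \<xi>) \<in> borel_measurable (lborel \<Otimes>\<^sub>M lborel)"
    unfolding e_def by measurable
  define fR where "fR = (\<lambda>R t. indicator {-R..R} t *\<^sub>R f t)"
  have [measurable]: "fR R \<in> borel_measurable borel" for R
    unfolding fR_def by measurable
  have fR_int: "integrable lborel (fR R)" for R
  proof -
    from L2_mult_integrable[OF indicator_Icc_L2 fL] show ?thesis
      unfolding fR_def by (rule Bochner_Integration.integrable_cong[THEN iffD1, rotated 2]) (auto simp: indicator_def)
  qed
  define FR where "FR = (\<lambda>R \<xi>. c * (LINT t:{-R..R}|lborel. f t * exp (- (\<i> * of_real t * of_real \<xi>))))"
  have FR_eq: "FR R \<xi> = c * (LINT t|lborel. fR R t * e t \<xi>)" for R \<xi>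
    by (simp add: FR_def set_lebesgue_integral_def fR_def e_def)
  have FR_meas [measurable]: "FR R \<in> borel_measurable borel" for R
    unfolding FR_eq[abs_def] by measurable
  have FR_bound: "cmod (FR R \<xi>) \<le> cmod c * (LINT t|lborel. cmod (fR R t))" for R \<xi>
    unfolding FR_eq norm_mult
    by (intro mult_left_mono order_trans[OF integral_norm_bound]) (auto simp: norm_mult e1)
  have FR\<gamma>_int: "integrable lborel (\<lambda>\<xi>. FR R \<xi> * \<gamma> \<xi>)" for R
    by (rule Bochner_Integration.integrable_bound[where f = "\<lambda>\<xi>. (cmod c * (LINT t|lborel. cmod (fR R t))) * cmod (\<gamma> \<xi>)"])
       (use \<gamma> FR_bound in \<open>auto simp: norm_mult intro!: AE_I2 mult_right_mono intro: order_trans\<close>)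
  have prod_int: "integrable (lborel \<Otimes>\<^sub>M lborel) (\<lambda>(t, \<xi>). fR R t * (\<gamma> \<xi> * e t \<xi>))" for R
  proof (rule lborel_pair.Fubini_integrable)
    show "(\<lambda>(t, \<xi>). fR R t * (\<gamma> \<xi> * e t \<xi>)) \<in> borel_measurable (lborel \<Otimes>\<^sub>M lborel)"
      by measurable
    show "integrable lborel (\<lambda>t. LINT \<xi>|lborel. norm (case (t, \<xi>) of (t, \<xi>) \<Rightarrow> fR R t * (\<gamma> \<xi> * e t \<xi>)))"
      using fR_int[of R] by (auto simp: norm_mult e1)
    have "integrable lborel (\<lambda>\<xi>. \<gamma> \<xi> * e t \<xi>)" for t
      by (rule Bochner_Integration.integrable_bound[OF \<gamma>(1)]) (auto simp: norm_mult e1 e_def)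
    then show "AE t in lborel. integrable lborel (\<lambda>\<xi>. case (t, \<xi>) of (t, \<xi>) \<Rightarrow> fR R t * (\<gamma> \<xi> * e t \<xi>))"
      by auto
  qed
  have dual: "(LINT \<xi>|lborel. FR R \<xi> * \<gamma> \<xi>) = c * (LINT t|lborel. fR R t * \<gamma>' t)" for R
  proof -
    have "(LINT \<xi>|lborel. FR R \<xi> * \<gamma> \<xi>) = c * (LINT \<xi>|lborel. (LINT t|lborel. fR R t * (\<gamma> \<xi> * e t \<xi>)))"
      unfolding FR_eq
      by (subst integral_mult_right_zero[symmetric], rule Bochner_Integration.integral_cong)
         (auto simp: mult.assoc integral_mult_left_zero[symmetric] simp del: integral_mult_left_zero intro!: Bochner_Integration.integral_cong)
    also have "(LINT \<xi>|lborel. (LINT t|lborel. fR R t * (\<gamma> \<xi> * e t \<xi>))) =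
        (LINT t|lborel. (LINT \<xi>|lborel. fR R t * (\<gamma> \<xi> * e t \<xi>)))"
      by (rule lborel_pair.Fubini_integral[OF prod_int])
    also have "\<dots> = (LINT t|lborel. fR R t * \<gamma>' t)"
      by (simp add: \<gamma>' e_def)
    finally show ?thesis .
  qed
  have rhs: "((\<lambda>R. c * (LINT t|lborel. fR R t * \<gamma>' t)) \<longlongrightarrow> c * (LINT t|lborel. f t * \<gamma>' t)) at_top"
  proof (intro tendsto_mult tendsto_const integral_dominated_convergence_at_top)
    show "integrable lborel (\<lambda>t. cmod (f t * \<gamma>' t))"
      using L2_mult_integrable[OF fL \<gamma>'(2)] by auto
    show "\<forall>\<^sub>F R in at_top. AE t in lborel. cmod (fR R t * \<gamma>' t) \<le> cmod (f t * \<gamma>' t)"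
      by (auto simp: fR_def indicator_def)
    show "AE t in lborel. ((\<lambda>R. fR R t * \<gamma>' t) \<longlongrightarrow> f t * \<gamma>' t) at_top"
    proof (intro AE_I2 tendsto_eventually)
      fix t show "\<forall>\<^sub>F R in at_top. fR R t * \<gamma>' t = f t * \<gamma>' t"
        using eventually_ge_at_top[of "\<bar>t\<bar>"] by eventually_elim (auto simp: fR_def indicator_def abs_le_iff)
    qed
  qed measurable
  define C where "C = (\<integral>\<^sup>+\<xi>. (ennreal (cmod (\<gamma> \<xi>)))\<^sup>2 \<partial>lborel)"
  have C_fin: "C < \<top>"
  proof -
    have "C = (\<integral>\<^sup>+\<xi>. ennreal ((cmod (\<gamma> \<xi>))\<^sup>2) \<partial>lborel)"
      unfolding C_def by (simp add: ennreal_power)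
    also have "\<dots> < \<top>"
      using \<gamma>(2) by (auto simp: L2_functions_def integrable_iff_bounded)
    finally show ?thesis .
  qed
  have F\<gamma>_int: "integrable lborel (\<lambda>\<xi>. F \<xi> * \<gamma> \<xi>)"
    by (rule L2_mult_integrable[OF FL \<gamma>(2)])
  have dist: "((\<lambda>R. L2_dist_sq (FR R) F) \<longlongrightarrow> 0) at_top"
    using FT unfolding has_L2_fourier_transform_def FR_def c_def by auto
  define D where "D = (\<lambda>R. cmod ((LINT \<xi>|lborel. FR R \<xi> * \<gamma> \<xi>) - (LINT \<xi>|lborel. F \<xi> * \<gamma> \<xi>)))"
  have le: "(ennreal (D R))\<^sup>2 \<le> L2_dist_sq (FR R) F * C" for R
  proof -
    have "ennreal (D R)
        = ennreal (cmod (LINT \<xi>|lborel. (FR R \<xi> - F \<xi>) * \<gamma> \<xi>))"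
      using FR\<gamma>_int[of R] F\<gamma>_int by (simp add: D_def algebra_simps)
    also have "\<dots> \<le> (\<integral>\<^sup>+\<xi>. norm ((FR R \<xi> - F \<xi>) * \<gamma> \<xi>) \<partial>lborel)"
      using FR\<gamma>_int[of R] F\<gamma>_int by (intro integral_norm_bound_ennreal) (auto simp: algebra_simps)
    also have "\<dots> = (\<integral>\<^sup>+\<xi>. ennreal (cmod (FR R \<xi> - F \<xi>)) * ennreal (cmod (\<gamma> \<xi>)) \<partial>lborel)"
      by (simp add: norm_mult ennreal_mult)
    finally have "(ennreal (D R))\<^sup>2
       \<le> (\<integral>\<^sup>+\<xi>. ennreal (cmod (FR R \<xi> - F \<xi>)) * ennreal (cmod (\<gamma> \<xi>)) \<partial>lborel)\<^sup>2"
      by (rule power_mono) simp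
    also have "\<dots> \<le> (\<integral>\<^sup>+\<xi>. (ennreal (cmod (FR R \<xi> - F \<xi>)))\<^sup>2 \<partial>lborel) * C"
      unfolding C_def by (rule Cauchy_Schwarz_nn_integral) measurable
    finally show ?thesis
      by (simp add: L2_dist_sq_def ennreal_power)
  qed
  have lim0: "((\<lambda>R. L2_dist_sq (FR R) F * C) \<longlongrightarrow> 0 * C) at_top"
    using C_fin by (intro tendsto_mult_ennreal dist tendsto_const) auto
  have "((\<lambda>R. (ennreal (D R))\<^sup>2) \<longlongrightarrow> 0) at_top"
  proof (rule tendsto_sandwich)
    show "\<forall>\<^sub>F R in at_top. 0 \<le> (ennreal (D R))\<^sup>2" by simp
    show "\<forall>\<^sub>F R in at_top. (ennreal (D R))\<^sup>2 \<le> L2_dist_sq (FR R) F * C"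
      by (rule always_eventually[OF allI[OF le]])
    show "((\<lambda>R. L2_dist_sq (FR R) F * C) \<longlongrightarrow> 0) at_top"
      using lim0 by simp
  qed (rule tendsto_const)
  moreover have D0: "0 \<le> D R" for R
    by (simp add: D_def)
  ultimately have "((\<lambda>R. ennreal ((D R)\<^sup>2)) \<longlongrightarrow> ennreal 0) at_top"
    by (simp add: ennreal_power)
  then have "((\<lambda>R. (D R)\<^sup>2) \<longlongrightarrow> 0) at_top"
    by (subst (asm) tendsto_ennreal_iff) auto
  then have "((\<lambda>R. sqrt ((D R)\<^sup>2)) \<longlongrightarrow> sqrt 0) at_top"
    by (rule tendsto_real_sqrt)
  then have "(D \<longlongrightarrow> 0) at_top"
    using D0 by simp
  then have "((\<lambda>R. (LINT \<xi>|lborel. FR R \<xi> * \<gamma> \<xi>)) \<longlongrightarrow> (LINT \<xi>|lborel. F \<xi> * \<gamma> \<xi>)) at_top"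
    unfolding D_def by (rule tendsto_norm_zero_cancel[THEN LIM_zero_cancel])
  then show ?thesis
    using rhs unfolding dual c_def by (intro tendsto_unique[of at_top]) simp_all
qed

text \<open>A square-integrable \<open>f\<close> need not be bounded, so the usual argument by substitution and dominated
  convergence covers only the part of \<open>f\<close> near \<open>x\<close>. Away from \<open>x\<close>, the kernels of standard
  deviation at most \<open>1\<close> are dominated by the standard normal one, against which \<open>f\<close> is integrable.\<close>

lemma gaussian_approximate_identity:
  assumes cont: "isCont f x" and fL: "f \<in> L2_functions"
    and bdd: "\<And>t. \<bar>t - x\<bar> \<le> 1 \<Longrightarrow> cmod (f t) \<le> M"
  shows "(\<lambda>n. LINT t|lborel. f t * of_real (Suc n * std_normal_density (Suc n * (t - x)))) \<longlonglongrightarrow> f x"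
proof -
  have [measurable]: "f \<in> borel_measurable borel"
    using fL by (auto simp: L2_functions_def)
  define f1 where "f1 = (\<lambda>t. indicator {x-1..x+1} t * f t)"
  define f2 where "f2 = (\<lambda>t. indicator (- {x-1..x+1}) t * f t)"
  have [measurable]: "f1 \<in> borel_measurable borel" "f2 \<in> borel_measurable borel"
    by (auto simp: f1_def f2_def)
  have M0: "0 \<le> M" using order_trans[OF norm_ge_zero bdd[of x]] by simp
  have f1_bdd: "cmod (f1 t) \<le> M" for t
    using bdd[of t] M0 by (auto simp: f1_def indicator_def abs_le_iff)
  define k where "k = (\<lambda>n t. Suc n * std_normal_density (Suc n * (t - x)))"
  have kL: "(\<lambda>t. complex_of_real (k n t)) \<in> L2_functions" for n
    unfolding k_def by (rule scaled_gaussian_L2)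
  have f1L: "f1 \<in> L2_functions" and f2L: "f2 \<in> L2_functions"
    using fL unfolding L2_functions_def
    by (auto intro: Bochner_Integration.integrable_bound[of lborel "\<lambda>t. (cmod (f t))\<^sup>2"]
        simp: f1_def f2_def norm_mult indicator_def)
  have lim1: "(\<lambda>n. LINT t|lborel. f1 t * of_real (k n t)) \<longlonglongrightarrow> f x"
  proof -
    have "(LINT t|lborel. f1 t * of_real (k n t)) =
       (LINT u|lborel. f1 (x + u / Suc n) * of_real (std_normal_density u))" for n
      by (subst lborel_integral_real_affine[of "1 / Suc n" _ x])
         (auto simp: k_def scaleR_conv_of_real divide_simps mult_ac simp del: of_nat_Suc)
    moreover have "(\<lambda>n. LINT u|lborel. f1 (x + u / Suc n) * of_real (std_normal_density u))
        \<longlonglongrightarrow> (LINT u|lborel. f x * of_real (std_normal_density u))"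
    proof (rule integral_dominated_convergence[where w = "\<lambda>u. M * std_normal_density u"])
      show "integrable lborel (\<lambda>u. M * std_normal_density u)"
        by auto
      show "AE u in lborel. norm (f1 (x + u / Suc n) * of_real (std_normal_density u)) \<le> M * std_normal_density u" for n
        using f1_bdd by (auto simp: norm_mult normal_density_nonneg intro!: mult_right_mono)
      show "AE u in lborel. (\<lambda>n. f1 (x + u / Suc n) * of_real (std_normal_density u)) \<longlonglongrightarrow> f x * of_real (std_normal_density u)"
      proof (intro AE_I2 tendsto_mult tendsto_const)
        fix u :: real
        have *: "(\<lambda>n. x + u / Suc n) \<longlonglongrightarrow> x"
          by real_asymp
        then have "(\<lambda>n. f (x + u / Suc n)) \<longlonglongrightarrow> f x"
          using cont by (rule isCont_tendsto_compose[rotated])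
        moreover have "\<forall>\<^sub>F n in sequentially. f (x + u / Suc n) = f1 (x + u / Suc n)"
          using eventually_conj[OF order_tendstoD(1)[OF *, of "x - 1"] order_tendstoD(2)[OF *, of "x + 1"]]
          by (auto elim!: eventually_mono simp: f1_def)
        ultimately show "(\<lambda>n. f1 (x + u / Suc n)) \<longlonglongrightarrow> f x"
          by (rule Lim_transform_eventually)
      qed
    qed measurable
    moreover have "(LINT u|lborel. f x * of_real (std_normal_density u)) = f x"
      by (simp add: integral_complex_of_real)
    ultimately show ?thesis by simp
  qed
  have lim2: "(\<lambda>n. LINT t|lborel. f2 t * of_real (k n t)) \<longlonglongrightarrow> (LINT t::real|lborel. 0)"
  proof (rule integral_dominated_convergence[where w = "\<lambda>t. cmod (f2 t * of_real (k 0 t))"])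
    show "integrable lborel (\<lambda>t. cmod (f2 t * of_real (k 0 t)))"
      using L2_mult_integrable[OF f2L kL] by auto
    show "AE t in lborel. norm (f2 t * of_real (k n t)) \<le> cmod (f2 t * of_real (k 0 t))" for n
    proof (rule AE_I2)
      fix t
      show "norm (f2 t * of_real (k n t)) \<le> cmod (f2 t * of_real (k 0 t))"
      proof (cases "t \<in> {x-1..x+1}")
        case False
        define m where "m = real (Suc n)"
        have m: "m \<ge> 1" by (simp add: m_def)
        have "1 < \<bar>t - x\<bar>" using False by auto
        then have s: "1 \<le> (t - x)\<^sup>2"
          by (simp add: abs_le_square_iff[of 1, simplified, symmetric])
        \<comment> \<open>The factor \<open>m\<close> of the kernel is absorbed by its exponential decay at distance at least \<open>1\<close>.\<close>
        have "m \<le> exp (m - 1)"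
          using exp_ge_add_one_self[of "m - 1"] by simp
        also have "\<dots> \<le> exp ((m\<^sup>2 - 1) * (t - x)\<^sup>2 / 2)"
        proof -
          have "0 \<le> (m - 1)\<^sup>2" by simp
          then have "2 * (m - 1) \<le> (m\<^sup>2 - 1) * 1"
            by (simp add: power2_eq_square algebra_simps)
          also have "\<dots> \<le> (m\<^sup>2 - 1) * (t - x)\<^sup>2"
            using m s by (intro mult_left_mono) auto
          finally show ?thesis by simp
        qed
        finally have "m * exp (- (m * (t - x))\<^sup>2 / 2) \<le> exp ((m\<^sup>2 - 1) * (t - x)\<^sup>2 / 2) * exp (- (m * (t - x))\<^sup>2 / 2)"
          by (rule mult_right_mono) simp
        also have "\<dots> = exp (- (t - x)\<^sup>2 / 2)"
          by (simp add: exp_add[symmetric] power_mult_distrib left_diff_distrib diff_divide_distrib)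
        finally have "k n t \<le> k 0 t"
          unfolding k_def std_normal_density_def m_def[symmetric]
            by (simp add: divide_right_mono)
        moreover have "0 \<le> k n t" by (simp add: k_def normal_density_nonneg)
        ultimately show ?thesis
          by (auto simp: norm_mult intro!: mult_left_mono)
      qed (auto simp: f2_def)
    qed
    show "AE t in lborel. (\<lambda>n. f2 t * of_real (k n t)) \<longlonglongrightarrow> 0"
    proof (rule AE_I2)
      fix t
      show "(\<lambda>n. f2 t * of_real (k n t)) \<longlonglongrightarrow> 0"
      proof (cases "t \<in> {x-1..x+1}")
        case False
        then have "0 < (t - x)\<^sup>2" by auto
        then have "(\<lambda>n. (1 / sqrt (2 * pi)) * (real (Suc n) * exp (- ((real (Suc n))\<^sup>2 * (t - x)\<^sup>2) / 2))) \<longlonglongrightarrow> (1 / sqrt (2 * pi)) * 0"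
          by (intro tendsto_mult tendsto_const) real_asymp
        then have "(\<lambda>n. k n t) \<longlonglongrightarrow> 0"
          by (simp add: k_def std_normal_density_def power_mult_distrib)
        then have "(\<lambda>n. f2 t * of_real (k n t)) \<longlonglongrightarrow> f2 t * of_real 0"
          by (intro tendsto_mult tendsto_of_real tendsto_const)
        then show ?thesis by simp
      qed (auto simp: f2_def)
    qed
    show "(\<lambda>t. f2 t * of_real (k n t)) \<in> borel_measurable lborel" for n
      unfolding k_def by measurable
  qed auto
  have "(LINT t|lborel. f1 t * of_real (k n t)) + (LINT t|lborel. f2 t * of_real (k n t))
      = (LINT t|lborel. f t * of_real (k n t))" for n
  proof -
    have "(LINT t|lborel. f t * of_real (k n t)) = (LINT t|lborel. f1 t * of_real (k n t) + f2 t * of_real (k n t))"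
      by (intro Bochner_Integration.integral_cong) (auto simp: f1_def f2_def indicator_def)
    also have "\<dots> = (LINT t|lborel. f1 t * of_real (k n t)) + (LINT t|lborel. f2 t * of_real (k n t))"
      by (intro Bochner_Integration.integral_add L2_mult_integrable f1L f2L kL)
    finally show ?thesis by simp
  qed
  then show ?thesis
    using tendsto_add[OF lim1 lim2] by (simp add: k_def)
qed

section \<open>Band-limited functions as Fourier integrals\<close>

text \<open>Duality is applied to the test functions \<open>\<gamma> x n\<close>, Gaussians of width \<open>n + 1\<close> modulated by
  \<open>e\<^sup>i\<^sup>x\<^sup>\<xi>\<close>. Their transforms are approximate identities at \<open>x\<close>, and they converge to a constant
  times \<open>e\<^sup>i\<^sup>x\<^sup>\<xi>\<close>. The bounded support makes \<open>F\<close> integrable, so that both limits can be taken;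
  the constant \<open>1 / sqrt (2 * pi)\<close> is absorbed into \<open>F\<close>.\<close>

lemma bandlimited_representation:
  assumes "f \<in> bandlimited \<omega>"
  obtains F where "integrable lborel F" "\<And>\<xi>. \<xi> \<notin> {-\<omega>..\<omega>} \<Longrightarrow> F \<xi> = 0"
    "\<And>x. f x = (LINT \<xi>|lborel. F \<xi> * exp (\<i> * of_real (x * \<xi>)))"
proof -
  from assms obtain F where cont: "continuous_on UNIV f" and fL: "f \<in> L2_functions"
    and FT: "has_L2_fourier_transform f F"
    and supp: "AE \<xi> in lborel. \<xi> \<notin> {-\<omega>..\<omega>} \<longrightarrow> F \<xi> = 0"
    by (auto simp: bandlimited_def)
  have FL: "F \<in> L2_functions"
    using FT by (simp add: has_L2_fourier_transform_def)
  have [measurable]: "F \<in> borel_measurable borel"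
    using FL by (simp add: L2_functions_def)
  define F' where "F' = (\<lambda>\<xi>. indicator {-\<omega>..\<omega>} \<xi> * F \<xi>)"
  have [measurable]: "F' \<in> borel_measurable borel"
    unfolding F'_def by measurable
  have ae: "AE \<xi> in lborel. F \<xi> = F' \<xi>"
    using supp by eventually_elim (auto simp: F'_def indicator_def)
  have F'_int: "integrable lborel F'"
    unfolding F'_def by (rule L2_mult_integrable[OF indicator_Icc_L2 FL])
  define \<gamma> where "\<gamma> = (\<lambda>x n \<xi>. exp (\<i> * complex_of_real (x * \<xi>)) * of_real (std_normal_density (\<xi> / Suc n)))"
  have [measurable]: "\<gamma> x n \<in> borel_measurable borel" for x n
    unfolding \<gamma>_def by measurable
  have \<gamma>_int: "integrable lborel (\<gamma> x n)" for x n
  proof (rule Bochner_Integration.integrable_bound)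
    show "integrable lborel (\<lambda>\<xi>. std_normal_density (0 + (1 / Suc n) * \<xi>))"
      by (rule lborel_integrable_real_affine) auto
  qed (auto simp: \<gamma>_def norm_mult)
  have \<gamma>_L2: "\<gamma> x n \<in> L2_functions" for x n
    using gaussian_L2[of "1 / Suc n" 0]
    by (simp add: L2_functions_def \<gamma>_def norm_mult)
  define k :: "real \<Rightarrow> nat \<Rightarrow> real \<Rightarrow> real" where "k = (\<lambda>(x::real) n (t::real). Suc n * std_normal_density (Suc n * (t - x)))"
  have kL: "(\<lambda>t. of_real (k x n t)) \<in> L2_functions" for x n
    unfolding k_def by (rule scaled_gaussian_L2)
  have \<gamma>_hat: "of_real (sqrt (2 * pi) * k x n t) = (LINT \<xi>|lborel. \<gamma> x n \<xi> * exp (- (\<i> * of_real t * of_real \<xi>)))" for x n t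
  proof -
    have "(LINT \<xi>|lborel. \<gamma> x n \<xi> * exp (- (\<i> * of_real t * of_real \<xi>))) =
       (LINT \<xi>|lborel. exp (\<i> * of_real ((x - t) * \<xi>)) * of_real (std_normal_density (\<xi> / Suc n)))"
      by (intro Bochner_Integration.integral_cong) (auto simp: \<gamma>_def exp_add[symmetric] algebra_simps exp_diff exp_minus divide_simps)
    also have "\<dots> = of_real (sqrt (2 * pi) * (Suc n * std_normal_density (Suc n * (x - t))))"
      by (rule fourier_gaussian) simp
    also have "std_normal_density (Suc n * (x - t)) = std_normal_density (Suc n * (t - x))"
      by (simp add: std_normal_density_def power_mult_distrib power2_commute)
    finally show ?thesis by (simp add: k_def)
  qed
  have dual: "(LINT \<xi>|lborel. F' \<xi> * \<gamma> x n \<xi>) = (LINT t|lborel. f t * of_real (k x n t))" for x n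
  proof -
    have "(LINT \<xi>|lborel. F' \<xi> * \<gamma> x n \<xi>) = (LINT \<xi>|lborel. F \<xi> * \<gamma> x n \<xi>)"
      using ae by (intro integral_cong_AE) auto
    also have "\<dots> = of_real (1 / sqrt (2 * pi)) * (LINT t|lborel. f t * of_real (sqrt (2 * pi) * k x n t))"
      using L2_cmult[OF kL[of x n], of "of_real (sqrt (2 * pi))"]
      by (intro fourier_duality[OF FT \<gamma>_int \<gamma>_L2 \<gamma>_hat]) simp
    also have "(LINT t|lborel. f t * of_real (sqrt (2 * pi) * k x n t)) =
        of_real (sqrt (2 * pi)) * (LINT t|lborel. f t * of_real (k x n t))"
      by (simp add: mult_ac flip: integral_mult_right_zero)
    finally show ?thesis by (simp flip: of_real_mult)
  qed
  have "f x = (LINT \<xi>|lborel. (of_real (1 / sqrt (2 * pi)) * F' \<xi>) * exp (\<i> * of_real (x * \<xi>)))" for x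
  proof (rule LIMSEQ_unique)
    have "compact (f ` {x-1..x+1})"
      using cont by (intro compact_continuous_image) (auto intro: continuous_on_subset)
    then obtain M where M: "\<And>t. t \<in> {x-1..x+1} \<Longrightarrow> cmod (f t) \<le> M"
      using compact_imp_bounded bounded_iff by (metis imageI)
    show "(\<lambda>n. LINT \<xi>|lborel. F' \<xi> * \<gamma> x n \<xi>) \<longlonglongrightarrow> f x"
      unfolding dual unfolding k_def
      using cont M by (intro gaussian_approximate_identity[OF _ fL, of _ M])
         (auto simp: continuous_on_eq_continuous_at abs_le_iff)
    show "(\<lambda>n. LINT \<xi>|lborel. F' \<xi> * \<gamma> x n \<xi>) \<longlonglongrightarrow>
        (LINT \<xi>|lborel. (of_real (1 / sqrt (2 * pi)) * F' \<xi>) * exp (\<i> * of_real (x * \<xi>)))"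
    proof (rule integral_dominated_convergence[where w = "\<lambda>\<xi>. cmod (F' \<xi>)"])
      show "AE \<xi> in lborel. norm (F' \<xi> * \<gamma> x n \<xi>) \<le> cmod (F' \<xi>)" for n
        using std_normal_density_le_1
        by (auto simp: \<gamma>_def norm_mult intro!: mult_left_le)
      show "AE \<xi> in lborel. (\<lambda>n. F' \<xi> * \<gamma> x n \<xi>) \<longlonglongrightarrow>
          (of_real (1 / sqrt (2 * pi)) * F' \<xi>) * exp (\<i> * of_real (x * \<xi>))"
      proof (rule AE_I2)
        fix \<xi> :: real
        have "(\<lambda>n. \<xi> / Suc n) \<longlonglongrightarrow> 0"
          by real_asymp
        moreover have "isCont std_normal_density 0"
          unfolding normal_density_def by (intro continuous_intros) auto
        ultimately have "(\<lambda>n. std_normal_density (\<xi> / Suc n)) \<longlonglongrightarrow> std_normal_density 0"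
          by (rule isCont_tendsto_compose[rotated])
        then have "(\<lambda>n. F' \<xi> * \<gamma> x n \<xi>) \<longlonglongrightarrow> F' \<xi> * (exp (\<i> * complex_of_real (x * \<xi>)) * of_real (std_normal_density 0))"
          unfolding \<gamma>_def by (intro tendsto_mult tendsto_const tendsto_of_real)
        then show "(\<lambda>n. F' \<xi> * \<gamma> x n \<xi>) \<longlonglongrightarrow>
          (of_real (1 / sqrt (2 * pi)) * F' \<xi>) * exp (\<i> * of_real (x * \<xi>))"
          by (simp add: std_normal_density_def mult_ac)
      qed
    qed (use F'_int in auto)
  qed
  with F'_int show thesis
    by (intro that[of "\<lambda>\<xi>. of_real (1 / sqrt (2 * pi)) * F' \<xi>"]) (auto simp: F'_def)
qed

lemma integrable_mult_bounded_support:
  fixes F :: "real \<Rightarrow> complex"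
  assumes F: "integrable lborel F" and supp: "\<And>\<xi>. \<xi> \<notin> {-\<omega>..\<omega>} \<Longrightarrow> F \<xi> = 0"
    and p: "continuous_on UNIV p"
  shows "integrable lborel (\<lambda>\<xi>. F \<xi> * p \<xi>)"
proof -
  have "compact (p ` {-\<omega>..\<omega>})"
    using p by (intro compact_continuous_image) (auto intro: continuous_on_subset)
  then obtain M where M: "\<And>t. t \<in> {-\<omega>..\<omega>} \<Longrightarrow> cmod (p t) \<le> M"
    using compact_imp_bounded bounded_iff by (metis imageI)
  show ?thesis
  proof (rule Bochner_Integration.integrable_bound)
    show "integrable lborel (\<lambda>\<xi>. of_real M * F \<xi>)" using F by simp
    have "p \<in> borel_measurable borel" using p by (rule borel_measurable_continuous_onI)
    then show "(\<lambda>\<xi>. F \<xi> * p \<xi>) \<in> borel_measurable lborel" using F by auto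
    have "cmod (F \<xi>) * cmod (p \<xi>) \<le> \<bar>M\<bar> * cmod (F \<xi>)" for \<xi>
    proof (cases "\<xi> \<in> {-\<omega>..\<omega>}")
      case True
      then have "cmod (p \<xi>) \<le> \<bar>M\<bar>" using M[of \<xi>] by linarith
      then show ?thesis by (subst mult.commute) (intro mult_right_mono, auto)
    qed (auto simp: supp)
    then show "AE \<xi> in lborel. norm (F \<xi> * p \<xi>) \<le> norm (of_real M * F \<xi>)"
      by (auto simp: norm_mult)
  qed
qed

text \<open>The remainder of the first-order expansion of \<open>e\<^sup>i\<^sup>u\<close> is at most \<open>u\<^sup>2\<close>, and the second moment
  of \<open>F\<close> is finite by its bounded support. So the remainder of the integral is quadratic in the
  increment.\<close>

lemma fourier_integral_has_derivative:
  fixes F :: "real \<Rightarrow> complex"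
  assumes F: "integrable lborel F" and supp: "\<And>\<xi>. \<xi> \<notin> {-\<omega>..\<omega>} \<Longrightarrow> F \<xi> = 0"
  shows "((\<lambda>x. LINT \<xi>|lborel. F \<xi> * exp (\<i> * of_real (x * \<xi>))) has_vector_derivative
          (LINT \<xi>|lborel. F \<xi> * (\<i> * of_real \<xi>) * exp (\<i> * of_real (x * \<xi>)))) (at x)"
  unfolding has_vector_derivative_def
proof (rule has_derivativeI_sandwich[where e = 1])
  define e where "e = (\<lambda>x \<xi>. exp (\<i> * complex_of_real (x * \<xi>)))"
  note int = integrable_mult_bounded_support[OF F supp]
  have i1: "integrable lborel (\<lambda>\<xi>. F \<xi> * e y \<xi>)" for y
    unfolding e_def by (intro int continuous_intros)
  have i2: "integrable lborel (\<lambda>\<xi>. F \<xi> * ((\<i> * of_real \<xi>) * e y \<xi>))" for y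
    unfolding e_def by (intro int continuous_intros)
  have i3: "integrable lborel (\<lambda>\<xi>. F \<xi> * (of_real (\<xi>\<^sup>2)))"
    by (intro int continuous_intros)
  define C where "C = (LINT \<xi>|lborel. cmod (F \<xi> * (of_real (\<xi>\<^sup>2))))"
  fix y :: real assume "y \<noteq> x"
  have "(LINT \<xi>|lborel. F \<xi> * e y \<xi>) - (LINT \<xi>|lborel. F \<xi> * e x \<xi>) - (y - x) *\<^sub>R (LINT \<xi>|lborel. F \<xi> * ((\<i> * of_real \<xi>) * e x \<xi>))
     = (LINT \<xi>|lborel. F \<xi> * e y \<xi> - F \<xi> * e x \<xi> - (y - x) *\<^sub>R (F \<xi> * ((\<i> * of_real \<xi>) * e x \<xi>)))"
    using i1 i2[of x] by simp
  also have "cmod \<dots> \<le> (LINT \<xi>|lborel. (y - x)\<^sup>2 * cmod (F \<xi> * (of_real (\<xi>\<^sup>2))))"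
  proof (rule order_trans[OF integral_norm_bound], rule integral_mono)
    show "integrable lborel (\<lambda>\<xi>. cmod (F \<xi> * e y \<xi> - F \<xi> * e x \<xi> - (y - x) *\<^sub>R (F \<xi> * ((\<i> * of_real \<xi>) * e x \<xi>))))"
      using i1 i2[of x] by simp
    show "integrable lborel (\<lambda>\<xi>. (y - x)\<^sup>2 * cmod (F \<xi> * (of_real (\<xi>\<^sup>2))))"
      using i3 by (intro integrable_mult_right integrable_norm)
    fix \<xi> :: real
    have "F \<xi> * e y \<xi> - F \<xi> * e x \<xi> - (y - x) *\<^sub>R (F \<xi> * ((\<i> * of_real \<xi>) * e x \<xi>))
       = F \<xi> * e x \<xi> * (e (y - x) \<xi> - (\<Sum>k\<le>1. (\<i> * of_real ((y - x) * \<xi>)) ^ k / fact k))"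
      by (simp add: e_def algebra_simps scaleR_conv_of_real exp_diff divide_simps)
    also have "cmod \<dots> \<le> cmod (F \<xi>) * \<bar>(y - x) * \<xi>\<bar>\<^sup>2"
    proof -
      have "cmod (e (y - x) \<xi> - (\<Sum>k\<le>1. (\<i> * of_real ((y - x) * \<xi>)) ^ k / fact k)) \<le> \<bar>(y - x) * \<xi>\<bar>\<^sup>2 / 2"
        using iexp_approx1[of "(y - x) * \<xi>" 1] unfolding e_def by (simp add: numeral_2_eq_2)
      also have "\<dots> \<le> \<bar>(y - x) * \<xi>\<bar>\<^sup>2"
        by simp
      finally show ?thesis
        unfolding norm_mult by (intro mult_mono) (auto simp: e_def)
    qed
    finally show "cmod (F \<xi> * e y \<xi> - F \<xi> * e x \<xi> - (y - x) *\<^sub>R (F \<xi> * ((\<i> * of_real \<xi>) * e x \<xi>)))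
       \<le> (y - x)\<^sup>2 * cmod (F \<xi> * (of_real (\<xi>\<^sup>2)))"
      by (simp add: norm_mult power_mult_distrib mult_ac norm_power)
  qed
  also have "\<dots> = (y - x)\<^sup>2 * C" by (simp add: C_def)
  finally have *: "norm ((LINT \<xi>|lborel. F \<xi> * e y \<xi>) - (LINT \<xi>|lborel. F \<xi> * e x \<xi>) -
       (y - x) *\<^sub>R (LINT \<xi>|lborel. F \<xi> * ((\<i> * of_real \<xi>) * e x \<xi>))) \<le> (y - x)\<^sup>2 * C" .
  show "norm ((LINT \<xi>|lborel. F \<xi> * exp (\<i> * of_real (y * \<xi>))) - (LINT \<xi>|lborel. F \<xi> * exp (\<i> * of_real (x * \<xi>))) -
       (y - x) *\<^sub>R (LINT \<xi>|lborel. F \<xi> * (\<i> * of_real \<xi>) * exp (\<i> * of_real (x * \<xi>)))) / norm (y - x)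
      \<le> \<bar>y - x\<bar> * (LINT \<xi>|lborel. cmod (F \<xi> * (of_real (\<xi>\<^sup>2))))"
    using * \<open>y \<noteq> x\<close> unfolding e_def C_def
    by (simp add: divide_simps mult.assoc power2_eq_square flip: abs_mult) (simp add: mult_ac)
next
  show "((\<lambda>y. \<bar>y - x\<bar> * (LINT \<xi>|lborel. cmod (F \<xi> * (of_real (\<xi>\<^sup>2))))) \<longlongrightarrow> 0) (at x)"
    by (auto intro!: tendsto_eq_intros)
qed (auto intro: bounded_linear_scaleR_left)

lemma nth_deriv_fourier_integral:
  fixes F :: "real \<Rightarrow> complex"
  assumes F: "integrable lborel F" and supp: "\<And>\<xi>. \<xi> \<notin> {-\<omega>..\<omega>} \<Longrightarrow> F \<xi> = 0"
  shows "nth_deriv j (\<lambda>x. LINT \<xi>|lborel. F \<xi> * exp (\<i> * of_real (x * \<xi>))) =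
         (\<lambda>x. LINT \<xi>|lborel. F \<xi> * (\<i> * of_real \<xi>) ^ j * exp (\<i> * of_real (x * \<xi>)))"
proof (induction j)
  case 0
  then show ?case by (simp add: nth_deriv_def)
next
  case (Suc j)
  have "integrable lborel (\<lambda>\<xi>. F \<xi> * (\<i> * of_real \<xi>) ^ j)"
    by (rule integrable_mult_bounded_support[OF F supp]) (auto intro!: continuous_intros)
  from fourier_integral_has_derivative[OF this] supp
  have "vector_derivative (\<lambda>x. LINT \<xi>|lborel. F \<xi> * (\<i> * of_real \<xi>) ^ j * exp (\<i> * of_real (x * \<xi>))) (at x)
    = (LINT \<xi>|lborel. F \<xi> * (\<i> * of_real \<xi>) ^ j * (\<i> * of_real \<xi>) * exp (\<i> * of_real (x * \<xi>)))" for x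
    by (intro vector_derivative_at) auto
  with Suc show ?case
    by (simp add: nth_deriv_def mult_ac)
qed

section \<open>Trigonometric polynomials\<close>

text \<open>The closure properties needed below are those of the span of the characters; presenting it
  inductively turns each identity for trigonometric polynomials into one for a single character.\<close>

inductive trig_poly :: "(real \<Rightarrow> complex) \<Rightarrow> bool" where
  monomial: "trig_poly (\<lambda>\<theta>. c * cis (of_int n * \<theta>))"
| add: "trig_poly p \<Longrightarrow> trig_poly q \<Longrightarrow> trig_poly (\<lambda>\<theta>. p \<theta> + q \<theta>)"

lemma trig_poly_const: "trig_poly (\<lambda>\<theta>. c)"
  using trig_poly.monomial[of c 0] by simp

lemma trig_poly_monomial_mult:
  "trig_poly p \<Longrightarrow> trig_poly (\<lambda>\<theta>. (c * cis (of_int n * \<theta>)) * p \<theta>)"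
proof (induction rule: trig_poly.induct)
  case (monomial d m)
  have "(\<lambda>\<theta>. (c * cis (of_int n * \<theta>)) * (d * cis (of_int m * \<theta>))) = (\<lambda>\<theta>. (c * d) * cis (of_int (n + m) * \<theta>))"
    by (simp add: fun_eq_iff ring_distribs flip: cis_mult)
  then show ?case by (simp only: trig_poly.monomial)
next
  case (add p q)
  then show ?case by (simp only: distrib_left trig_poly.add)
qed

lemma trig_poly_mult: "trig_poly p \<Longrightarrow> trig_poly q \<Longrightarrow> trig_poly (\<lambda>\<theta>. p \<theta> * q \<theta>)"
proof (induction rule: trig_poly.induct)
  case (monomial c n)
  then show ?case by (rule trig_poly_monomial_mult)
next
  case (add p p')
  then show ?case by (simp only: distrib_right trig_poly.add)
qed

lemma trig_poly_continuous: "trig_poly p \<Longrightarrow> continuous_on A p"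
  by (induction rule: trig_poly.induct) (auto intro!: continuous_intros)

text \<open>A real-linear form on the plane restricts to the unit circle as a combination of
  \<open>cis \<theta>\<close> and \<open>cis (- \<theta>)\<close>.\<close>

lemma trig_poly_real_polynomial:
  "real_polynomial_function g \<Longrightarrow> trig_poly (\<lambda>\<theta>. of_real (g (cis \<theta>)))"
proof (induction rule: real_polynomial_function.induct)
  case (linear g)
  then interpret bounded_linear g .
  have lin: "g z = Re z * g 1 + Im z * g \<i>" for z
  proof -
    have "z = Re z *\<^sub>R 1 + Im z *\<^sub>R \<i>" by (simp add: complex_eq_iff)
    then have "g z = g (Re z *\<^sub>R 1 + Im z *\<^sub>R \<i>)" by (rule arg_cong)
    then show ?thesis by (simp only: add scaleR real_scaleR_def)
  qed
  have g: "complex_of_real (g (cis \<theta>)) = of_real (cos \<theta>) * of_real (g 1) + of_real (sin \<theta>) * of_real (g \<i>)" for \<theta>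
    unfolding lin[of "cis \<theta>"] by simp
  have c: "cis (of_int 1 * \<theta>) = of_real (cos \<theta>) + \<i> * of_real (sin \<theta>)"
    "cis (of_int (-1) * \<theta>) = of_real (cos \<theta>) - \<i> * of_real (sin \<theta>)" for \<theta>
    by (simp_all add: complex_eq_iff)
  have "(\<lambda>\<theta>. complex_of_real (g (cis \<theta>))) = (\<lambda>\<theta>.
     ((of_real (g 1) - \<i> * of_real (g \<i>)) / 2) * cis (of_int 1 * \<theta>) +
     ((of_real (g 1) + \<i> * of_real (g \<i>)) / 2) * cis (of_int (-1) * \<theta>))"
    unfolding g c by (simp add: fun_eq_iff field_simps)
  then show ?case by (simp only: trig_poly.intros)
next
  case (const c)
  show ?case by (rule trig_poly_const)
next
  case (add f g)
  then show ?case by (simp add: trig_poly.add)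
next
  case (mult f g)
  then show ?case by (simp add: trig_poly_mult)
qed

lemma trig_poly_dense:
  assumes "continuous_on (sphere 0 1) G" "e > 0"
  obtains p where "trig_poly p" "\<And>\<theta>. cmod (G (cis \<theta>) - p \<theta>) < e"
proof -
  obtain g where g: "polynomial_function g" "\<And>z. z \<in> sphere 0 1 \<Longrightarrow> cmod (G z - g z) < e"
    using Stone_Weierstrass_polynomial_function[of "sphere 0 1 :: complex set" G e] assms by auto
  have "real_polynomial_function (Re \<circ> g)" "real_polynomial_function (Im \<circ> g)"
    using g(1) bounded_linear_Re bounded_linear_Im by (auto simp: polynomial_function_def)
  then have "trig_poly (\<lambda>\<theta>. of_real (Re (g (cis \<theta>))) + \<i> * of_real (Im (g (cis \<theta>))))"
    by (intro trig_poly.add trig_poly_mult trig_poly_const) (auto dest: trig_poly_real_polynomial)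
  then have "trig_poly (\<lambda>\<theta>. g (cis \<theta>))"
    by (simp flip: complex_eq)
  then show thesis
    using g(2) by (intro that[of "\<lambda>\<theta>. g (cis \<theta>)"]) auto
qed

lemma integral_cis:
  "integral {-pi..pi} (\<lambda>\<theta>. cis (of_int n * \<theta>)) = (if n = 0 then of_real (2 * pi) else 0)"
proof (cases "n = 0")
  case False
  have "((\<lambda>\<theta>. cis (of_int n * \<theta>)) has_integral
     (cis (of_int n * pi) / (\<i> * of_int n) - cis (of_int n * (- pi)) / (\<i> * of_int n))) {-pi..pi}"
  proof (rule fundamental_theorem_of_calculus)
    fix \<theta> :: real
    have "((\<lambda>z. exp (\<i> * of_int n * z) / (\<i> * of_int n)) has_field_derivative exp (\<i> * of_int n * of_real \<theta>)) (at (of_real \<theta>))"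
      using False by (auto intro!: derivative_eq_intros)
    from has_vector_derivative_real_field[OF this]
    show "((\<lambda>\<theta>. cis (of_int n * \<theta>) / (\<i> * of_int n)) has_vector_derivative cis (of_int n * \<theta>)) (at \<theta> within {-pi..pi})"
      by (simp add: cis_conv_exp mult.assoc)
  qed auto
  moreover have "cis (of_int n * pi) = cis (of_int n * (- pi))"
    using sin_npi_int[of n] by (simp add: complex_eq_iff mult.commute)
  ultimately show ?thesis
    using False by (simp add: integral_unique)
qed (simp add: scaleR_conv_of_real)

text \<open>The coefficient of index \<open>m\<close> is recovered by integrating against \<open>cis (m \<theta>)\<close>.\<close>

lemma trig_sum_zero_imp_coeff_zero:
  fixes h :: "int \<Rightarrow> complex"
  assumes "finite I" and zero: "\<And>\<theta>. (\<Sum>n\<in>I. h n * cis (- (of_int n * \<theta>))) = 0" and "m \<in> I"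
  shows "h m = 0"
proof -
  have "0 = integral {-pi..pi} (\<lambda>\<theta>. (\<Sum>n\<in>I. h n * cis (- (of_int n * \<theta>))) * cis (of_int m * \<theta>))"
    by (simp add: zero)
  also have "(\<lambda>\<theta>. (\<Sum>n\<in>I. h n * cis (- (of_int n * \<theta>))) * cis (of_int m * \<theta>)) = (\<lambda>\<theta>. \<Sum>n\<in>I. h n * cis (of_int (m - n) * \<theta>))"
    by (simp add: fun_eq_iff sum_distrib_right mult.assoc cis_mult left_diff_distrib)
  also have "integral {-pi..pi} \<dots> = (\<Sum>n\<in>I. h n * integral {-pi..pi} (\<lambda>\<theta>. cis (of_int (m - n) * \<theta>)))"
    using \<open>finite I\<close> by (subst integral_sum) (auto intro!: integrable_continuous_real continuous_intros simp: integral_mult_right)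
  also have "\<dots> = (\<Sum>n\<in>I. if n = m then h m * of_real (2 * pi) else 0)"
    by (intro sum.cong) (auto simp: integral_cis simp del: of_int_diff)
  also have "\<dots> = h m * of_real (2 * pi)"
    using assms by simp
  finally show ?thesis by simp
qed

section \<open>Samples as Fourier coefficients\<close>

text \<open>Here \<open>c n\<close> is the Fourier integral of \<open>F\<close> at the point \<open>n t\<close>. For a single character in place
  of \<open>G\<close>, both sides are a multiple of one \<open>c m\<close>, which is zero if \<open>m\<close> is not in \<open>I\<close>. The
  difference \<open>A\<close> of the sides is linear in \<open>G\<close> and bounded by a multiple of its supremum norm,
  where finiteness of \<open>I\<close> enters; so the identity extends to uniform limits. The phase
  \<open>\<beta>\<close> serves to place a chosen residue of frequencies at the origin of the circle.\<close>

lemma sampling_identity: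
  fixes F G :: "_ \<Rightarrow> complex" and t \<beta> :: real
  defines "c \<equiv> \<lambda>n. LINT \<xi>|lborel. F \<xi> * exp (\<i> * of_real (of_int n * t * \<xi>))"
  assumes F: "integrable lborel F" and I: "finite I" "\<And>n. n \<notin> I \<Longrightarrow> c n = 0"
    and G: "continuous_on (sphere 0 1) G"
  shows "(LINT \<xi>|lborel. F \<xi> * G (cis (t * \<xi> + \<beta>))) =
         (\<Sum>n\<in>I. c n * cis (of_int n * \<beta>) *
            (integral {-pi..pi} (\<lambda>\<theta>. G (cis \<theta>) * cis (- (of_int n * \<theta>))) / of_real (2 * pi)))"
proof -
  define A where "A = (\<lambda>q. (LINT \<xi>|lborel. F \<xi> * q (t * \<xi> + \<beta>)) -
      (\<Sum>n\<in>I. c n * cis (of_int n * \<beta>) * (integral {-pi..pi} (\<lambda>\<theta>. q \<theta> * cis (- (of_int n * \<theta>))) / of_real (2 * pi))))"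
  have int1: "integrable lborel (\<lambda>\<xi>. F \<xi> * q (t * \<xi> + \<beta>))"
    if q: "continuous_on UNIV q" and M: "\<And>\<theta>. cmod (q \<theta>) \<le> M" for q M
  proof (rule Bochner_Integration.integrable_bound)
    show "integrable lborel (\<lambda>\<xi>. of_real M * F \<xi>)" using F by simp
    have "(\<lambda>\<xi>. q (t * \<xi> + \<beta>)) \<in> borel_measurable borel"
      by (intro borel_measurable_continuous_onI continuous_on_compose2[OF q] continuous_intros) auto
    then show "(\<lambda>\<xi>. F \<xi> * q (t * \<xi> + \<beta>)) \<in> borel_measurable lborel" using F by auto
    have "0 \<le> M" using order_trans[OF norm_ge_zero M] .
    then have "norm (F \<xi> * q (t * \<xi> + \<beta>)) \<le> norm (of_real M * F \<xi>)" for \<xi>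
      using mult_right_mono[OF M[of "t * \<xi> + \<beta>"], of "cmod (F \<xi>)"] by (simp add: norm_mult mult.commute)
    then show "AE \<xi> in lborel. norm (F \<xi> * q (t * \<xi> + \<beta>)) \<le> norm (of_real M * F \<xi>)"
      by (rule AE_I2)
  qed
  have int2: "(\<lambda>\<theta>. q \<theta> * cis (- (of_int n * \<theta>))) integrable_on {-pi..pi}"
    if q: "continuous_on UNIV q" for q :: "real \<Rightarrow> complex" and n
    by (intro integrable_continuous_real continuous_intros) (auto intro: continuous_on_subset[OF q])
  have A_add: "A (\<lambda>\<theta>. p \<theta> + q \<theta>) = A p + A q"
    if p: "continuous_on UNIV p" "\<And>\<theta>. cmod (p \<theta>) \<le> M" and q: "continuous_on UNIV q" "\<And>\<theta>. cmod (q \<theta>) \<le> N" for p q M N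
    using int1[OF p] int1[OF q] int2[OF p(1)] int2[OF q(1)]
    by (simp add: A_def distrib_left distrib_right add_divide_distrib sum.distrib Henstock_Kurzweil_Integration.integral_add)
  have A_bound: "cmod (A q) \<le> e * ((LINT \<xi>|lborel. cmod (F \<xi>)) + (\<Sum>n\<in>I. cmod (c n)))"
    if q: "continuous_on UNIV q" and e: "\<And>\<theta>. cmod (q \<theta>) \<le> e" for q e
  proof -
    have "cmod (LINT \<xi>|lborel. F \<xi> * q (t * \<xi> + \<beta>)) \<le> (LINT \<xi>|lborel. e * cmod (F \<xi>))"
    proof (rule order_trans[OF integral_norm_bound], rule integral_mono)
      show "integrable lborel (\<lambda>\<xi>. cmod (F \<xi> * q (t * \<xi> + \<beta>)))"
        using int1[OF q e] by (rule integrable_norm)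
      show "integrable lborel (\<lambda>\<xi>. e * cmod (F \<xi>))"
        using F by simp
      show "cmod (F \<xi> * q (t * \<xi> + \<beta>)) \<le> e * cmod (F \<xi>)" for \<xi>
        using mult_right_mono[OF e[of "t * \<xi> + \<beta>"], of "cmod (F \<xi>)"] by (simp add: norm_mult mult.commute)
    qed
    moreover have "cmod (\<Sum>n\<in>I. c n * cis (of_int n * \<beta>) * (integral {-pi..pi} (\<lambda>\<theta>. q \<theta> * cis (- (of_int n * \<theta>))) / of_real (2 * pi)))
       \<le> (\<Sum>n\<in>I. e * cmod (c n))"
    proof (rule sum_norm_le)
      fix n
      have "cmod (integral {-pi..pi} (\<lambda>\<theta>. q \<theta> * cis (- (of_int n * \<theta>)))) \<le> e * (pi - (- pi))"
        by (rule integral_bound) (use e in \<open>auto simp: norm_mult intro!: continuous_intros continuous_on_subset[OF q]\<close>)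
      then have "cmod (integral {-pi..pi} (\<lambda>\<theta>. q \<theta> * cis (- (of_int n * \<theta>))) / of_real (2 * pi)) \<le> e"
        by (simp add: norm_divide divide_simps mult_ac)
      from mult_left_mono[OF this norm_ge_zero[of "c n"]]
      show "cmod (c n * cis (of_int n * \<beta>) * (integral {-pi..pi} (\<lambda>\<theta>. q \<theta> * cis (- (of_int n * \<theta>))) / of_real (2 * pi))) \<le> e * cmod (c n)"
        unfolding norm_mult by (simp only: norm_cis mult_1_right mult.commute[of e])
    qed
    ultimately show ?thesis
      unfolding A_def distrib_left by (intro order_trans[OF norm_triangle_ineq4] add_mono) (auto simp: sum_distrib_left)
  qed
  have A_trig: "A p = 0 \<and> (\<exists>M. \<forall>\<theta>. cmod (p \<theta>) \<le> M)" if "trig_poly p" for p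
    using that
  proof induction
    case (monomial d m)
    have "(LINT \<xi>|lborel. F \<xi> * (d * cis (of_int m * (t * \<xi> + \<beta>)))) = d * cis (of_int m * \<beta>) * c m"
    proof -
      have "F \<xi> * (d * cis (of_int m * (t * \<xi> + \<beta>))) =
          (d * cis (of_int m * \<beta>)) * (F \<xi> * exp (\<i> * of_real (of_int m * t * \<xi>)))" for \<xi>
        by (simp add: cis_conv_exp distrib_left exp_add mult_ac)
      then show ?thesis unfolding c_def by (simp only: integral_mult_right_zero)
    qed
    moreover have "integral {-pi..pi} (\<lambda>\<theta>. d * cis (of_int m * \<theta>) * cis (- (of_int n * \<theta>))) = (if n = m then d * of_real (2 * pi) else 0)" for n
    proof -
      have "(\<lambda>\<theta>. d * cis (of_int m * \<theta>) * cis (- (of_int n * \<theta>))) = (\<lambda>\<theta>. d * cis (of_int (m - n) * \<theta>))"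
        by (simp add: fun_eq_iff cis_mult algebra_simps)
      then show ?thesis by (simp only: integral_mult_right integral_cis) auto
    qed
    ultimately have "A (\<lambda>\<theta>. d * cis (of_int m * \<theta>)) = d * cis (of_int m * \<beta>) * c m -
       (\<Sum>n\<in>I. c n * cis (of_int n * \<beta>) * ((if n = m then d * of_real (2 * pi) else 0) / of_real (2 * pi)))"
      unfolding A_def by (simp only:)
    also have "(\<Sum>n\<in>I. c n * cis (of_int n * \<beta>) * ((if n = m then d * of_real (2 * pi) else 0) / of_real (2 * pi)))
       = (\<Sum>n\<in>I. if n = m then d * cis (of_int m * \<beta>) * c m else 0)"
      by (intro sum.cong) auto
    also have "d * cis (of_int m * \<beta>) * c m - \<dots> = 0"
      using I by (simp add: sum.delta)
    finally show ?case
      by (auto simp: norm_mult)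
  next
    case (add p q)
    then obtain M N where MN: "\<And>\<theta>. cmod (p \<theta>) \<le> M" "\<And>\<theta>. cmod (q \<theta>) \<le> N" by blast
    have "A (\<lambda>\<theta>. p \<theta> + q \<theta>) = 0"
      using A_add[of p M q N] MN add by (simp add: trig_poly_continuous)
    moreover have "cmod (p \<theta> + q \<theta>) \<le> M + N" for \<theta>
      using MN by (intro order_trans[OF norm_triangle_ineq] add_mono)
    ultimately show ?case by blast
  qed
  define K where "K = (LINT \<xi>|lborel. cmod (F \<xi>)) + (\<Sum>n\<in>I. cmod (c n))"
  have K: "0 \<le> K" unfolding K_def by (intro add_nonneg_nonneg sum_nonneg Bochner_Integration.integral_nonneg) auto
  have "cmod (A (\<lambda>\<theta>. G (cis \<theta>))) \<le> 0 + e" if e: "e > 0" for e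
  proof -
    obtain p where p: "trig_poly p" "\<And>\<theta>. cmod (G (cis \<theta>) - p \<theta>) < e / (K + 1)"
      using trig_poly_dense[OF G, of "e / (K + 1)"] e K by auto
    obtain M where M: "\<And>\<theta>. cmod (p \<theta>) \<le> M" using A_trig[OF p(1)] by blast
    have Gc: "continuous_on UNIV (\<lambda>\<theta>. G (cis \<theta>))"
      by (intro continuous_on_compose2[OF G] continuous_intros) auto
    have c: "continuous_on UNIV (\<lambda>\<theta>. G (cis \<theta>) - p \<theta>)"
      by (intro continuous_intros Gc trig_poly_continuous p)
    have "A (\<lambda>\<theta>. p \<theta> + (G (cis \<theta>) - p \<theta>)) = A p + A (\<lambda>\<theta>. G (cis \<theta>) - p \<theta>)"
      by (rule A_add[OF trig_poly_continuous[OF p(1)] M c less_imp_le[OF p(2)]])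
    then have "cmod (A (\<lambda>\<theta>. G (cis \<theta>))) = cmod (A (\<lambda>\<theta>. G (cis \<theta>) - p \<theta>))"
      using A_trig[OF p(1)] by simp
    also have "\<dots> \<le> e / (K + 1) * K"
      unfolding K_def by (rule A_bound[OF c]) (use p(2) in \<open>auto simp: K_def intro: less_imp_le\<close>)
    also have "\<dots> \<le> e" using e K by (simp add: field_simps)
    finally show ?thesis by simp
  qed
  then have "cmod (A (\<lambda>\<theta>. G (cis \<theta>))) \<le> 0" by (rule field_le_epsilon)
  then show ?thesis by (simp add: A_def)
qed

text \<open>Each \<open>F \<xi> (\<i>\<xi>)\<^sup>j\<close> is tested against its own continuous function \<open>G j\<close> on the circle. On the
  right, the inner sum is the trigonometric polynomial that represents the periodization of
  \<open>F \<xi> (\<i>\<xi>)\<^sup>j\<close>.\<close>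

lemma derivative_sampling_identity:
  fixes F :: "real \<Rightarrow> complex" and t \<beta> :: real and L :: nat
  defines "H \<equiv> \<lambda>j n. LINT \<xi>|lborel. F \<xi> * (\<i> * of_real \<xi>) ^ j * exp (\<i> * of_real (of_int n * t * \<xi>))"
  assumes F: "integrable lborel F" and supp: "\<And>\<xi>. \<xi> \<notin> {-\<omega>..\<omega>} \<Longrightarrow> F \<xi> = 0"
    and I: "finite I" "\<And>n j. n \<notin> I \<Longrightarrow> j < L \<Longrightarrow> H j n = 0"
    and G: "\<And>j. j < L \<Longrightarrow> continuous_on (sphere 0 1) (G j)"
  shows "(LINT \<xi>|lborel. F \<xi> * (\<Sum>j<L. (\<i> * of_real \<xi>) ^ j * G j (cis (t * \<xi> + \<beta>)))) =
     integral {-pi..pi} (\<lambda>\<theta>. \<Sum>j<L. G j (cis \<theta>) *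
        (\<Sum>n\<in>I. H j n * cis (of_int n * \<beta>) * cis (- (of_int n * \<theta>)))) / of_real (2 * pi)"
proof -
  have Gc: "continuous_on A (\<lambda>x. G j (cis (f x)))" if "j < L" "continuous_on A f" for j f and A :: "real set"
    using that by (intro continuous_on_compose2[OF G] continuous_intros) auto
  have int: "integrable lborel (\<lambda>\<xi>. F \<xi> * (\<i> * of_real \<xi>) ^ j * G j (cis (t * \<xi> + \<beta>)))" if "j < L" for j
    unfolding mult.assoc
    by (rule integrable_mult_bounded_support[OF F supp]) (use that in \<open>auto intro!: continuous_intros Gc\<close>)
  have int': "integrable lborel (\<lambda>\<xi>. F \<xi> * (\<i> * of_real \<xi>) ^ j)" for j
    by (rule integrable_mult_bounded_support[OF F supp]) (auto intro!: continuous_intros)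
  have io: "(\<lambda>\<theta>. G j (cis \<theta>) * cis (- (of_int n * \<theta>))) integrable_on {-pi..pi}" if "j < L" for j n
    using that by (intro integrable_continuous_real continuous_intros Gc)
  have "(LINT \<xi>|lborel. F \<xi> * (\<Sum>j<L. (\<i> * of_real \<xi>) ^ j * G j (cis (t * \<xi> + \<beta>)))) =
      (LINT \<xi>|lborel. (\<Sum>j<L. F \<xi> * (\<i> * of_real \<xi>) ^ j * G j (cis (t * \<xi> + \<beta>))))"
    by (simp add: sum_distrib_left mult.assoc)
  also have "\<dots> = (\<Sum>j<L. (LINT \<xi>|lborel. F \<xi> * (\<i> * of_real \<xi>) ^ j * G j (cis (t * \<xi> + \<beta>))))"
    by (rule Bochner_Integration.integral_sum) (auto intro: int)
  also have "\<dots> = (\<Sum>j<L. \<Sum>n\<in>I. H j n * cis (of_int n * \<beta>) *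
            (integral {-pi..pi} (\<lambda>\<theta>. G j (cis \<theta>) * cis (- (of_int n * \<theta>))) / of_real (2 * pi)))"
    unfolding H_def
    by (intro sum.cong refl sampling_identity int' I(1) G) (use I(2) in \<open>auto simp: H_def\<close>)
  also have "\<dots> = (\<Sum>j<L. \<Sum>n\<in>I. integral {-pi..pi} (\<lambda>\<theta>. H j n * cis (of_int n * \<beta>) * (G j (cis \<theta>) * cis (- (of_int n * \<theta>))))) / of_real (2 * pi)"
    unfolding sum_divide_distrib by (intro sum.cong refl) (simp only: integral_mult_right times_divide_eq_right)
  also have "(\<Sum>j<L. \<Sum>n\<in>I. integral {-pi..pi} (\<lambda>\<theta>. H j n * cis (of_int n * \<beta>) * (G j (cis \<theta>) * cis (- (of_int n * \<theta>)))))
     = integral {-pi..pi} (\<lambda>\<theta>. \<Sum>j<L. \<Sum>n\<in>I. H j n * cis (of_int n * \<beta>) * (G j (cis \<theta>) * cis (- (of_int n * \<theta>))))"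
  proof -
    have "(\<lambda>\<theta>. H j n * cis (of_int n * \<beta>) * (G j (cis \<theta>) * cis (- (of_int n * \<theta>)))) integrable_on {-pi..pi}" if "j < L" for j n
      using io[OF that] by (rule integrable_on_mult_right)
    then show ?thesis
      using I(1)
      by (subst Henstock_Kurzweil_Integration.integral_sum)
         (auto intro!: integrable_sum sum.cong simp: Henstock_Kurzweil_Integration.integral_sum simp del: integral_mult_right)
  qed
  also have "(\<lambda>\<theta>. \<Sum>j<L. \<Sum>n\<in>I. H j n * cis (of_int n * \<beta>) * (G j (cis \<theta>) * cis (- (of_int n * \<theta>)))) =
     (\<lambda>\<theta>. \<Sum>j<L. G j (cis \<theta>) * (\<Sum>n\<in>I. H j n * cis (of_int n * \<beta>) * cis (- (of_int n * \<theta>))))"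
    by (simp add: sum_distrib_left mult_ac)
  finally show ?thesis .
qed


section \<open>Products over consecutive nodes\<close>

text \<open>Two windows of \<open>d + 1\<close> consecutive nodes that differ by one step share \<open>d\<close> nodes, and the
  difference of their products is a nonzero constant times the product over the shared nodes. So
  vanishing passes from windows of length \<open>N\<close> down to all shorter ones. Windows of each length
  give monic polynomials of each degree up to \<open>N\<close>, a triangular basis.\<close>

lemma functional_zero_if_zero_on_windows:
  fixes a :: "int \<Rightarrow> complex" and T :: "nat \<Rightarrow> complex"
  assumes inj: "inj a"
    and zero: "\<And>m. (\<Sum>j\<le>N. coeff (\<Prod>k<N. [:- a (m + int k), 1:]) j * T j) = 0"
    and "j \<le> N"
  shows "T j = 0"
proof -
  define \<Lambda> where "\<Lambda> = (\<lambda>p. \<Sum>j\<le>N. coeff p j * T j)"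
  define W where "W = (\<lambda>d m. \<Prod>k<d. [:- a (m + int k), 1:])"
  have \<Lambda>_W: "\<Lambda> (W d m) = 0" if "d \<le> N" for d m
    using that
  proof (induction arbitrary: m rule: inc_induct)
    case base
    show ?case using zero by (simp add: \<Lambda>_def W_def)
  next
    case (step d)
    have 1: "W (Suc d) m = W d m * [:- a (m + int d), 1:]"
      by (simp add: W_def mult.commute)
    have 2: "W (Suc d) (m - 1) = [:- a (m - 1), 1:] * W d m"
      unfolding W_def by (subst prod.lessThan_Suc_shift) (simp add: algebra_simps)
    have "W (Suc d) m - W (Suc d) (m - 1) = smult (a (m - 1) - a (m + int d)) (W d m)"
      unfolding 1 2 by (simp add: algebra_simps smult_diff_left)
    then have "\<Lambda> (smult (a (m - 1) - a (m + int d)) (W d m)) = \<Lambda> (W (Suc d) m - W (Suc d) (m - 1))"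
      by simp
    also have "\<dots> = 0"
      using step.IH[of m] step.IH[of "m - 1"] by (simp add: \<Lambda>_def left_diff_distrib sum_subtractf)
    finally have "(a (m - 1) - a (m + int d)) * \<Lambda> (W d m) = 0"
      by (simp add: \<Lambda>_def sum_distrib_left mult_ac)
    moreover have "a (m - 1) \<noteq> a (m + int d)"
      using inj by (auto dest!: injD)
    ultimately show ?case by simp
  qed
  have deg: "degree (W d m) = d" "coeff (W d m) d = 1" for d m
  proof -
    show *: "degree (W d m) = d"
      unfolding W_def by (subst degree_prod_eq_sum_degree) auto
    have "lead_coeff (W d m) = 1"
      unfolding W_def lead_coeff_prod by simp
    then show "coeff (W d m) d = 1" by (simp add: *)
  qed
  show ?thesis
    using \<open>j \<le> N\<close>
  proof (induction j rule: less_induct)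
    case (less j)
    have "0 = \<Lambda> (W j 0)" using \<Lambda>_W less by simp
    also have "\<dots> = (\<Sum>i\<le>N. if i = j then T j else 0)"
      unfolding \<Lambda>_def
    proof (rule sum.cong)
      fix i assume "i \<in> {..N}"
      then show "coeff (W j 0) i * T i = (if i = j then T j else 0)"
        using less.IH[of i] deg(2)[of j 0] coeff_eq_0[of "W j 0" i] deg(1)[of j 0]
        by (cases i j rule: linorder_cases) auto
    qed simp
    also have "\<dots> = T j" using less.prems by simp
    finally show ?case by simp
  qed
qed


text \<open>With \<open>t \<xi> = s - L \<pi> + 2 \<pi> k\<close>, the node is \<open>\<i>\<xi>\<close>: the nodes for fixed \<open>z = s\<close> are \<open>\<i>\<close> times
  the frequencies of one residue class modulo \<open>2\<pi>/t\<close>. The argument is complex so that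
  analytic continuation in it makes sense.\<close>

definition node :: "real \<Rightarrow> nat \<Rightarrow> complex \<Rightarrow> int \<Rightarrow> complex" where
  "node t L z k = \<i> * (z - of_real (L * pi) + of_real (2 * pi) * of_int k) / of_real t"

text \<open>For a small \<open>s > 0\<close> the indices \<open>1, \<dots>, L - 1\<close> are those whose frequencies can lie in the band:
  index \<open>0\<close> is to its left and index \<open>L\<close> to its right.\<close>

definition node_poly :: "real \<Rightarrow> nat \<Rightarrow> complex \<Rightarrow> complex poly" where
  "node_poly t L z = (\<Prod>k<L - 1. [:- node t L z (1 + int k), 1:])"

lemma node_shift: "node t L (z + of_real (2 * pi) * of_int r) k = node t L z (k + r)"
  by (simp add: node_def algebra_simps)

lemma holomorphic_coeff_mult:
  assumes "\<And>j. (\<lambda>z. coeff (p z) j) holomorphic_on A" "\<And>j. (\<lambda>z. coeff (q z) j) holomorphic_on A"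
  shows "(\<lambda>z. coeff (p z * q z) j) holomorphic_on A"
  unfolding coeff_mult by (intro holomorphic_intros assms)

lemma holomorphic_coeff_node_poly: "(\<lambda>z. coeff (node_poly t L z) j) holomorphic_on A"
proof -
  have lin: "(\<lambda>z. coeff [:- node t L z m, 1:] j) holomorphic_on A" for j m
    by (cases j) (auto simp: node_def divide_inverse coeff_pCons split: nat.splits intro!: holomorphic_intros)
  have "(\<lambda>z. coeff (\<Prod>k<N. [:- node t L z (1 + int k), 1:]) j) holomorphic_on A" for N j
  proof (induction N arbitrary: j)
    case 0
    show ?case by simp
  next
    case (Suc N)
    show ?case
      unfolding prod.lessThan_Suc by (rule holomorphic_coeff_mult[OF Suc lin])
  qed
  then show ?thesis by (simp add: node_poly_def)
qed

lemma degree_node_poly: "degree (node_poly t L z) = L - 1"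
  unfolding node_poly_def by (subst degree_prod_eq_sum_degree) auto

text \<open>The hypotheses on sine and cosine say that the residue \<open>s\<close> of \<open>t \<xi> + L \<pi>\<close> modulo \<open>2 \<pi>\<close> lies strictly
  between \<open>0\<close> and \<open>\<alpha>\<close>. Since \<open>t \<xi> + L \<pi>\<close> lies between \<open>\<alpha>\<close> and \<open>2 L \<pi> - \<alpha>\<close>, it is
  \<open>s + 2 \<pi> k\<close> with \<open>1 \<le> k < L\<close>, so \<open>\<i>\<xi>\<close> is a root.\<close>

lemma poly_node_poly_band:
  assumes "t > 0" "0 < \<alpha>" "\<alpha> \<le> pi" "\<omega> * t \<le> real L * pi - \<alpha>" "\<xi> \<in> {-\<omega>..\<omega>}"
    and sin: "sin (t * \<xi> + real L * pi) > 0" and cos: "cos (t * \<xi> + real L * pi) > cos \<alpha>"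
  shows "poly (node_poly t L (of_real (arccos (cos (t * \<xi> + real L * pi))))) (\<i> * of_real \<xi>) = 0"
proof -
  define \<theta> where "\<theta> = t * \<xi> + real L * pi"
  define k where "k = \<lfloor>\<theta> / (2 * pi)\<rfloor>"
  define s where "s = \<theta> - 2 * pi * of_int k"
  have "of_int k \<le> \<theta> / (2 * pi)" "\<theta> / (2 * pi) < of_int k + 1"
    by (simp_all add: k_def)
  then have s: "0 \<le> s" "s < 2 * pi"
    using pi_gt_zero by (simp_all add: s_def field_simps)
  have \<theta>: "\<theta> = s + 2 * pi * of_int k" by (simp add: s_def)
  have sc: "sin \<theta> = sin s" "cos \<theta> = cos s"
    unfolding \<theta> by (simp_all add: sin_add cos_add)
  have "s < pi"
    using sin sin_le_zero[of s] s unfolding \<theta>_def[symmetric] sc by (cases "s < pi") auto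
  then have "s < \<alpha>"
    using cos s assms(2,3) unfolding \<theta>_def[symmetric] sc by (simp add: cos_mono_less_eq)
  have "s \<noteq> 0" using sin unfolding \<theta>_def[symmetric] sc by auto
  have arc: "arccos (cos \<theta>) = s"
    unfolding sc using s \<open>s < pi\<close> by (intro arccos_cos) auto
  have "t * \<xi> \<le> t * \<omega>" "t * (- \<omega>) \<le> t * \<xi>"
    using assms(1,5) mult_left_mono[of "- \<omega>" \<xi> t] mult_left_mono[of \<xi> \<omega> t] by auto
  moreover have "2 * pi * real L = real L * pi + real L * pi" by simp
  ultimately have bounds: "\<alpha> \<le> \<theta>" "\<theta> < 2 * pi * real L"
    using assms(2,4) unfolding \<theta>_def mult.commute[of \<omega>] mult_minus_right by linarith+
  have "1 \<le> k"
  proof (rule ccontr)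
    assume "\<not> 1 \<le> k"
    then have "2 * pi * of_int k \<le> 0" by (simp add: mult_nonneg_nonpos)
    then show False using bounds \<theta> \<open>s < \<alpha>\<close> by linarith
  qed
  moreover have "k < int L"
  proof -
    have "2 * pi * of_int k < 2 * pi * real L" using bounds \<theta> s by linarith
    then have "of_int k < real L" by simp
    then show ?thesis by linarith
  qed
  ultimately have k: "nat (k - 1) < L - 1" "1 + int (nat (k - 1)) = k" by auto
  have "\<xi> = (s - real L * pi + 2 * pi * of_int k) / t"
    using \<open>t > 0\<close> \<theta> by (simp add: \<theta>_def field_simps)
  then have "\<i> * of_real \<xi> = node t L (of_real s) k"
    by (simp add: node_def)
  then have "poly [:- node t L (of_real s) (1 + int (nat (k - 1))), 1:] (\<i> * of_real \<xi>) = 0"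
    using k by simp
  then show ?thesis
    unfolding \<theta>_def[symmetric] arc node_poly_def poly_prod
    using k(1) by (intro prod_zero bexI[of _ "nat (k - 1)"]) auto
qed


section \<open>Recovery of finitely many samples\<close>

text \<open>The elimination argument. Here \<open>E\<close> combines the trigonometric polynomials \<open>T j\<close> with the
  coefficients of the node polynomial. The test functions \<open>G j\<close> live on an arc of length \<open>\<alpha>\<close>,
  where they are these coefficients times the conjugate of \<open>E\<close> and a weight \<open>b\<close>. On the frequency
  side the node polynomial is evaluated at its roots and the integral is zero; on the circle the
  integrand is \<open>b \<bar>E\<bar>\<^sup>2\<close>, so \<open>E\<close> vanishes on the arc.\<close>

lemma missing_samples_vanish:
  fixes F :: "real \<Rightarrow> complex" and t \<omega> \<alpha> :: real and L :: nat
  defines "H \<equiv> \<lambda>j n. LINT \<xi>|lborel. F \<xi> * (\<i> * of_real \<xi>) ^ j * exp (\<i> * of_real (of_int n * t * \<xi>))"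
  assumes F: "integrable lborel F" and supp: "\<And>\<xi>. \<xi> \<notin> {-\<omega>..\<omega>} \<Longrightarrow> F \<xi> = 0"
    and t: "t > 0" and \<alpha>: "0 < \<alpha>" "\<alpha> \<le> pi" "\<omega> * t \<le> real L * pi - \<alpha>"
    and I: "finite I" "\<And>n j. n \<notin> I \<Longrightarrow> j < L \<Longrightarrow> H j n = 0"
    and jL: "j < L"
  shows "H j n = 0"
proof -
  define h where "h = (\<lambda>j n. H j n * cis (of_int n * (real L * pi)))"
  define T where "T = (\<lambda>j z. \<Sum>n\<in>I. h j n * exp (- (\<i> * of_int n * z)))"
  define E where "E = (\<lambda>z. \<Sum>j<L. coeff (node_poly t L z) j * T j z)"
  have T_real: "T j (of_real \<theta>) = (\<Sum>n\<in>I. H j n * cis (of_int n * (real L * pi)) * cis (- (of_int n * \<theta>)))" for j \<theta>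
    by (simp add: T_def h_def cis_conv_exp mult.assoc)
  have T_per: "T j (z + of_real (2 * pi) * of_int r) = T j z" for j z r
    unfolding T_def
  proof (intro sum.cong refl)
    fix n
    have "exp (- (\<i> * of_int n * (z + of_real (2 * pi) * of_int r))) = exp (- (\<i> * of_int n * z) + of_int (- n * r) * (of_real (2 * pi) * \<i>))"
      by (simp add: algebra_simps)
    also have "\<dots> = exp (- (\<i> * of_int n * z))"
    proof -
      have "exp (of_int (- n * r) * (of_real (2 * pi) * \<i>)) = (1 :: complex)"
        using exp_integer_2pi[of "of_int (- n * r)"] by (simp add: mult_ac del: of_int_mult of_int_minus)
      then show ?thesis unfolding exp_add by simp
    qed
    finally show "h j n * exp (- (\<i> * of_int n * (z + of_real (2 * pi) * of_int r))) = h j n * exp (- (\<i> * of_int n * z))"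
      by simp
  qed
  have E_hol: "E holomorphic_on UNIV"
    unfolding E_def T_def by (intro holomorphic_intros holomorphic_coeff_node_poly)
  have E_cont: "continuous_on A (\<lambda>x. E (f x))" if "continuous_on A f" for f and A :: "'z::topological_space set"
    using holomorphic_on_imp_continuous_on[OF E_hol] that by (rule continuous_on_compose2) auto
  have c_cont: "continuous_on A (\<lambda>x. coeff (node_poly t L (f x)) j)" if "continuous_on A f" for j f and A :: "'z::topological_space set"
    using holomorphic_on_imp_continuous_on[OF holomorphic_coeff_node_poly[where A = UNIV]] that by (rule continuous_on_compose2) auto
  \<comment> \<open>The weight is positive exactly on the open arc from angle \<open>0\<close> to angle \<open>\<alpha>\<close>. On it, \<open>s\<close> below is
    the angle; elsewhere \<open>s\<close> only has to be continuous, because the weight is zero.\<close>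
  define b where "b = (\<lambda>w. max 0 (Im w) * max 0 (Re w - cos \<alpha>))"
  define s where "s = (\<lambda>w. complex_of_real (arccos (Re w)))"
  define G where "G = (\<lambda>j w. of_real (b w) * coeff (node_poly t L (s w)) j * cnj (E (s w)))"
  have s_cont: "continuous_on (sphere 0 1) s"
    unfolding s_def
  proof (intro continuous_intros ballI)
    fix w :: complex assume "w \<in> sphere 0 1"
    then have "\<bar>Re w\<bar> \<le> 1" using abs_Re_le_cmod[of w] by simp
    then show "- 1 \<le> Re w \<and> Re w \<le> 1" by auto
  qed
  have b_cont: "continuous_on A b" for A
    unfolding b_def by (intro continuous_intros)
  have G_cont: "continuous_on (sphere 0 1) (G j)" for j
    unfolding G_def by (intro continuous_intros b_cont c_cont E_cont s_cont)
  have "F \<xi> * (\<Sum>j<L. (\<i> * of_real \<xi>) ^ j * G j (cis (t * \<xi> + real L * pi))) = 0" for \<xi>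
  proof (cases "\<xi> \<in> {-\<omega>..\<omega>} \<and> b (cis (t * \<xi> + real L * pi)) \<noteq> 0")
    case True
    define w where "w = cis (t * \<xi> + real L * pi)"
    have "0 = poly (node_poly t L (s w)) (\<i> * of_real \<xi>)"
      using True poly_node_poly_band[OF t \<alpha>, of \<xi>] by (auto simp: w_def s_def b_def max_def split: if_splits)
    also have "\<dots> = (\<Sum>j<L. coeff (node_poly t L (s w)) j * (\<i> * of_real \<xi>) ^ j)"
      using jL by (subst poly_altdef, unfold degree_node_poly, intro sum.cong) auto
    finally have "(of_real (b w) * cnj (E (s w))) * (\<Sum>j<L. coeff (node_poly t L (s w)) j * (\<i> * of_real \<xi>) ^ j) = 0"
      by simp
    then have "(\<Sum>j<L. (\<i> * of_real \<xi>) ^ j * G j w) = 0"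
      unfolding sum_distrib_left G_def by (simp only: mult_ac)
    then show ?thesis by (simp add: w_def)
  qed (auto simp: supp G_def)
  then have "(LINT \<xi>|lborel. F \<xi> * (\<Sum>j<L. (\<i> * of_real \<xi>) ^ j * G j (cis (t * \<xi> + real L * pi)))) = 0"
    by (simp only: integral_zero)
  then have int0: "integral {-pi..pi} (\<lambda>\<theta>. \<Sum>j<L. G j (cis \<theta>) * T j (of_real \<theta>)) = 0"
    using derivative_sampling_identity[OF F supp I[unfolded H_def] G_cont, where \<beta> = "real L * pi"]
    by (simp add: T_real H_def)
  define P where "P = (\<lambda>\<theta>. b (cis \<theta>) * (cmod (E (of_real \<theta>)))\<^sup>2)"
  have P_eq: "(\<Sum>j<L. G j (cis \<theta>) * T j (of_real \<theta>)) = of_real (P \<theta>)" if "\<theta> \<in> {-pi..pi}" for \<theta>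
  proof (cases "b (cis \<theta>) = 0")
    case False
    then have "sin \<theta> > 0" by (auto simp: b_def max_def split: if_splits)
    then have "0 \<le> \<theta>" using that sin_ge_zero[of "-\<theta>"] by (cases "0 \<le> \<theta>") auto
    then have "s (cis \<theta>) = of_real \<theta>" using that by (simp add: s_def arccos_cos)
    then have "(\<Sum>j<L. G j (cis \<theta>) * T j (of_real \<theta>)) = of_real (b (cis \<theta>)) * cnj (E (of_real \<theta>)) *
        (\<Sum>j<L. coeff (node_poly t L (of_real \<theta>)) j * T j (of_real \<theta>))"
      by (simp add: G_def sum_distrib_left mult_ac)
    also have "(\<Sum>j<L. coeff (node_poly t L (of_real \<theta>)) j * T j (of_real \<theta>)) = E (of_real \<theta>)"
      by (simp add: E_def)
    also have "of_real (b (cis \<theta>)) * cnj (E (of_real \<theta>)) * \<dots> = of_real (P \<theta>)"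
      using complex_norm_square[of "E (of_real \<theta>)"] by (simp add: P_def mult_ac)
    finally show ?thesis .
  qed (simp add: G_def P_def)
  have P_cont: "continuous_on {-pi..pi} P"
    unfolding P_def by (intro continuous_intros E_cont continuous_on_compose2[OF b_cont[of UNIV]]) auto
  have "integral {-pi..pi} (\<lambda>\<theta>. complex_of_real (P \<theta>)) = 0"
    unfolding int0[symmetric] by (rule Henstock_Kurzweil_Integration.integral_cong[OF P_eq[symmetric]])
  moreover have "integral {-pi..pi} (complex_of_real \<circ> P) = of_real (integral {-pi..pi} P)"
    by (intro integral_linear integrable_continuous_real P_cont bounded_linear_of_real)
  ultimately have "integral {-pi..pi} P = 0"
    by (simp add: o_def)
  then have P0: "P \<theta> = 0" if "\<theta> \<in> {-pi..pi}" for \<theta>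
    using that integral_eq_0_iff[OF P_cont] by (auto simp: P_def b_def)
  have E0: "E (of_real \<theta>) = 0" if "0 < \<theta>" "\<theta> < \<alpha>" for \<theta>
  proof -
    have "sin \<theta> > 0" using that \<alpha> by (intro sin_gt_zero) auto
    moreover have "cos \<theta> > cos \<alpha>" using that \<alpha> by (intro cos_monotone_0_pi) auto
    ultimately show ?thesis using P0[of \<theta>] that \<alpha> by (auto simp: P_def b_def)
  qed
  \<comment> \<open>\<open>E\<close> is entire and vanishes on a real interval.\<close>
  have E_zero: "E z = 0" for z
  proof (rule analytic_continuation[OF E_hol, of "of_real ` {0<..<\<alpha>}" "of_real 0"])
    have "(0::real) islimpt {0<..<\<alpha>}" using \<alpha> by (simp add: islimpt_greaterThanLessThan1)
    then show "complex_of_real 0 islimpt of_real ` {0<..<\<alpha>}"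
      by (rule islimpt_isCont_image) (auto simp: eventually_at_filter)
  qed (use E0 in auto)
  have T0: "T j z = 0" if "j \<le> L - 1" for j z
  proof (rule functional_zero_if_zero_on_windows[where a = "node t L z" and N = "L - 1", OF _ _ that])
    show "inj (node t L z)"
      using t by (auto simp: inj_def node_def)
    fix m
    \<comment> \<open>The window of nodes in \<open>node_poly\<close> begins at index \<open>1\<close>, so a shift by \<open>m - 1\<close> makes it begin at \<open>m\<close>.\<close>
    have "0 = E (z + of_real (2 * pi) * of_int (m - 1))" by (simp add: E_zero)
    also have "\<dots> = (\<Sum>j<L. coeff (node_poly t L (z + of_real (2 * pi) * of_int (m - 1))) j * T j z)"
      unfolding E_def T_per ..
    also have "node_poly t L (z + of_real (2 * pi) * of_int (m - 1)) = (\<Prod>k<L - 1. [:- node t L z (m + int k), 1:])"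
      unfolding node_poly_def node_shift by (simp add: algebra_simps)
    also have "{..<L} = {..L - 1}" using jL by auto
    finally show "(\<Sum>j\<le>L - 1. coeff (\<Prod>k<L - 1. [:- node t L z (m + int k), 1:]) j * T j z) = 0" ..
  qed
  show ?thesis
  proof (cases "n \<in> I")
    case True
    have "h j n = 0"
    proof (rule trig_sum_zero_imp_coeff_zero[OF I(1) _ True])
      show "(\<Sum>n\<in>I. h j n * cis (- (of_int n * \<theta>))) = 0" for \<theta>
        using T0[of j "of_real \<theta>"] jL by (simp add: T_real h_def)
    qed
    then show ?thesis by (simp add: h_def)
  qed (use I(2) jL in auto)
qed


theorem proposition4p4:
  fixes \<omega> t\<^sub>o :: real and L :: nat
    and \<phi> \<phi>' :: "nat \<Rightarrow> real \<Rightarrow> complex"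
    and I :: "int set"
    and f g :: "real \<Rightarrow> complex"
  assumes "\<omega> > 0" and "L > 1"
    and "(real L - 1) * (pi / \<omega>) < t\<^sub>o" and "t\<^sub>o < real L * (pi / \<omega>)"
    and "\<And>j. j \<in> {1..L} \<Longrightarrow> \<phi> j \<in> bandlimited \<omega>"
    and "\<And>j. j \<in> {1..L} \<Longrightarrow> has_L2_fourier_transform (\<phi> j)
            (\<lambda>x. (\<i> * of_real x) ^ (j - 1) * indicator {-\<omega>..\<omega>} x)"
    and "dual_generators \<omega> L t\<^sub>o \<phi> \<phi>'"
    and "finite I"
    and "f \<in> bandlimited \<omega>" and "g \<in> bandlimited \<omega>"
    and "\<And>n j. n \<notin> I \<Longrightarrow> j \<in> {0..L - 1} \<Longrightarrow>
            nth_deriv j f (of_int n * t\<^sub>o) = nth_deriv j g (of_int n * t\<^sub>o)"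
  shows "\<forall>n\<in>I. \<forall>j\<in>{0..L - 1}.
            nth_deriv j f (of_int n * t\<^sub>o) = nth_deriv j g (of_int n * t\<^sub>o)"
proof (intro ballI)
  fix n j assume j: "j \<in> {0..L - 1}"
  obtain F where F: "integrable lborel F" "\<And>\<xi>. \<xi> \<notin> {-\<omega>..\<omega>} \<Longrightarrow> F \<xi> = 0"
    "f = (\<lambda>x. LINT \<xi>|lborel. F \<xi> * exp (\<i> * of_real (x * \<xi>)))"
    using bandlimited_representation[OF \<open>f \<in> bandlimited \<omega>\<close>] by (metis (no_types, lifting) ext)
  obtain K where K: "integrable lborel K" "\<And>\<xi>. \<xi> \<notin> {-\<omega>..\<omega>} \<Longrightarrow> K \<xi> = 0"
    "g = (\<lambda>x. LINT \<xi>|lborel. K \<xi> * exp (\<i> * of_real (x * \<xi>)))"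
    using bandlimited_representation[OF \<open>g \<in> bandlimited \<omega>\<close>] by (metis (no_types, lifting) ext)
  have deriv: "nth_deriv j f x = (LINT \<xi>|lborel. F \<xi> * (\<i> * of_real \<xi>) ^ j * exp (\<i> * of_real (x * \<xi>)))"
    "nth_deriv j g x = (LINT \<xi>|lborel. K \<xi> * (\<i> * of_real \<xi>) ^ j * exp (\<i> * of_real (x * \<xi>)))" for j x
    unfolding F(3) K(3)
    by (rule fun_cong[OF nth_deriv_fourier_integral[OF F(1,2)]] fun_cong[OF nth_deriv_fourier_integral[OF K(1,2)]], assumption)+
  have diff: "(LINT \<xi>|lborel. (F \<xi> - K \<xi>) * (\<i> * of_real \<xi>) ^ j * exp (\<i> * of_real (x * \<xi>))) =
      nth_deriv j f x - nth_deriv j g x" for j x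
  proof -
    have "integrable lborel (\<lambda>\<xi>. F \<xi> * ((\<i> * of_real \<xi>) ^ j * exp (\<i> * of_real (x * \<xi>))))"
      by (rule integrable_mult_bounded_support[OF F(1,2)]) (auto intro!: continuous_intros)
    moreover have "integrable lborel (\<lambda>\<xi>. K \<xi> * ((\<i> * of_real \<xi>) ^ j * exp (\<i> * of_real (x * \<xi>))))"
      by (rule integrable_mult_bounded_support[OF K(1,2)]) (auto intro!: continuous_intros)
    ultimately show ?thesis
      unfolding deriv
      by (simp add: left_diff_distrib mult.assoc)
  qed
  have L1: "real L - 1 > 0" using \<open>L > 1\<close> by simp
  have t: "t\<^sub>o > 0"
    using mult_pos_pos[OF L1, of "pi / \<omega>"] assms(1,3) by simp
  \<comment> \<open>The bounds on the step say that the arc length \<open>\<alpha>\<close> is positive and at most \<open>\<pi>\<close>.\<close>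
  define \<alpha> where "\<alpha> = real L * pi - \<omega> * t\<^sub>o"
  have \<alpha>: "0 < \<alpha>" "\<alpha> \<le> pi"
    using assms(1,3,4) by (simp_all add: \<alpha>_def field_simps)
  have "(LINT \<xi>|lborel. (F \<xi> - K \<xi>) * (\<i> * of_real \<xi>) ^ j * exp (\<i> * of_real (of_int n * t\<^sub>o * \<xi>))) = 0"
  proof (rule missing_samples_vanish[where \<omega> = \<omega> and \<alpha> = \<alpha> and I = I and L = L])
    show "j < L" using j \<open>L > 1\<close> by auto
    show "(LINT \<xi>|lborel. (F \<xi> - K \<xi>) * (\<i> * of_real \<xi>) ^ j * exp (\<i> * of_real (of_int n * t\<^sub>o * \<xi>))) = 0"
      if "n \<notin> I" "j < L" for n j
      unfolding diff using assms(11)[OF that(1), of j] that(2) by auto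
  qed (use F K t \<alpha> \<open>finite I\<close> in \<open>auto simp: \<alpha>_def\<close>)
  then show "nth_deriv j f (of_int n * t\<^sub>o) = nth_deriv j g (of_int n * t\<^sub>o)"
    unfolding diff by simp
qed

end
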